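(* Let $a,b,c,\mu\in\mathbb{C}$ with $\operatorname{Re}\mu>0$. Each of the following identities holds for the indicated $x$ under the indicated additional conditions, provided the lower (third) parameters of the hypergeometric functions occurring in the two functions $w_j$ in that identity are not in $\mathbb{Z}_{\le0}$. (1) For $x\in(-\infty,0)\cup(0,1)$, $\operatorname{Re}c>0$: $$\int_{0<y/x<1}|y|^{c-1}w_1(y;a,b,c)\tfrac{|x-y|^{\mu-1}}{\Gamma(\mu)}dy=\tfrac{\Gamma(c)}{\Gamma(c+\mu)}|x|^{c+\mu-1}w_1(x;a,b,c+\mu).$$ (2) For $x\in(-\infty,0)\cup(0,1)$, $\operatorname{Re}(a-c+1)>\operatorname{Re}\mu$, $\operatorname{Re}(b-c+1)>\operatorname{Re}\mu$: $$\int_{-\infty}^x|y|^{c-1}w_2(y;a,b,c)\tfrac{(x-y)^{\mu-1}}{\Gamma(\mu)}dy=\tfrac{\Gamma(a-c-\mu+1)}{\Gamma(a-c+1)}\tfrac{\Gamma(b-c-\mu+1)}{\Gamma(b-c+1)}\tfrac{\Gamma(2-c)}{\Gamma(2-c-\mu)}|x|^{c+\mu-1}w_2(x;a,b,c+\mu).$$ (3) For $x\in(-\infty,0)\cup(1,\infty)$, $\operatorname{Re}(a-c+1)>\operatorname{Re}\mu$: $$\int_{y/x>1}|y|^{c-1}w_3(y;a,b,c)\tfrac{|x-y|^{\mu-1}}{\Gamma(\mu)}dy=\tfrac{\Gamma(a-c-\mu+1)}{\Gamma(a-c+1)}|x|^{c+\mu-1}w_3(x;a,b,c+\mu).$$ (4)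 For $x\in(-\infty,0)\cup(1,\infty)$, $\operatorname{Re}(b-c+1)>\operatorname{Re}\mu$: $$\int_{y/x>1}|y|^{c-1}w_4(y;a,b,c)\tfrac{|x-y|^{\mu-1}}{\Gamma(\mu)}dy=\tfrac{\Gamma(b-c-\mu+1)}{\Gamma(b-c+1)}|x|^{c+\mu-1}w_4(x;a,b,c+\mu).$$ (5) For $x\in(0,\infty)$, $\operatorname{Re}(a-c+1)>\operatorname{Re}\mu$, $\operatorname{Re}(b-c+1)>\operatorname{Re}\mu$: $$\int_x^\infty y^{c-1}w_5(y;a,b,c)\tfrac{(y-x)^{\mu-1}}{\Gamma(\mu)}dy=\tfrac{\Gamma(b-c-\mu+1)}{\Gamma(b-c+1)}\tfrac{\Gamma(a-c-\mu+1)}{\Gamma(a-c+1)}\tfrac{\Gamma(a+b-c+1)}{\Gamma(a+b-c-\mu+1)}x^{c+\mu-1}w_5(x;a,b,c+\mu).$$ (6) For $x\in(0,1)\cup(1,\infty)$, $\operatorname{Re}(c-a-b+1)>0$: $$\int_{0<\frac{1-y}{1-x}<1}y^{c-1}w_6(y;a,b,c)\tfrac{|y-x|^{\mu-1}}{\Gamma(\mu)}dy=\tfrac{\Gamma(c-a-b+1)}{\Gamma(c-a-b+\mu+1)}x^{c+\mu-1}w_6(x;a,b,c+\mu).$$ (7) For $x\in(-\infty,0)\cup(0,1)$, $\operatorname{Re}(a-c+1)>\operatorname{Re}\mu$: $$\int_{0<y/x<1}|y|^{a-\mu-1}w_2(y;a,b,c)\tfrac{|x-y|^{\mu-1}}{\Gamma(\mu)}dy=\tfrac{\Gamma(a-c-\mu+1)}{\Gamma(a-c+1)}|x|^{a-1}w_2(x;a-\mu,b,c).$$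 (8) For $x\in(-\infty,0)\cup(1,\infty)$, $\operatorname{Re}b>\operatorname{Re}\mu$: $$\int_{y/x>1}w_4(y;a,b,c)\tfrac{|x-y|^{\mu-1}}{\Gamma(\mu)}dy=\tfrac{\Gamma(b-\mu)}{\Gamma(b)}w_4(x;a-\mu,b-\mu,c-\mu).$$ (9) For $x\in(0,1)\cup(1,\infty)$, $\operatorname{Re}(c-a-b+1)>0$: $$\int_{0<\frac{1-y}{1-x}<1}w_6(y;a,b,c)\tfrac{|x-y|^{\mu-1}}{\Gamma(\mu)}dy=\tfrac{\Gamma(c-a-b+1)}{\Gamma(c-a-b+\mu+1)}w_6(x;a-\mu,b-\mu,c-\mu).$$
   Context: Write $F(a,b;c;z)={}_2F_1(a,b;c;z)$ for the Gauss hypergeometric function (power series for $|z|<1$, analytically continued to $\mathbb{C}\setminus[1,\infty)$, with $c\notin\mathbb{Z}_{\le0}$). The six solutions of the hypergeometric differential equation on real intervals are $w_1(x;a,b,c)=F(a,b;c;x)$ for $x\in(-\infty,1)$; $w_2(x;a,b,c)=|x|^{1-c}F(a-c+1,b-c+1;2-c;x)$ for $x\in(-\infty,0)\cup(0,1)$; $w_3(x;a,b,c)=|x|^{-a}F(a,a-c+1;a-b+1;x^{-1})$ for $x\in(-\infty,0)\cup(1,\infty)$; $w_4(x;a,b,c)=|x|^{-b}F(b,b-c+1;b-a+1;x^{-1})$ for $x\in(-\infty,0)\cup(1,\infty)$; $w_5(x;a,b,c)=F(a,b;a+b-c+1;1-x)$ for $x\in(0,\infty)$; $w_6(x;a,b,c)=|1-x|^{c-a-b}F(c-a,c-b;c-a-b+1;1-x)$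 for $x\in(0,1)\cup(1,\infty)$. Integrals over sets such as $0<y/x<1$ are Lebesgue integrals over the set of real $y$ satisfying the condition (with $x$ fixed). *)

theory Defs
  imports "HOL-Complex_Analysis.Complex_Analysis"
begin

definition hyp2F1_series :: "complex \<Rightarrow> complex \<Rightarrow> complex \<Rightarrow> complex \<Rightarrow> complex" where
  "hyp2F1_series a b c z =
     (\<Sum>n. pochhammer a n * pochhammer b n / (pochhammer c n * fact n) * z ^ n)"

definition slit_plane :: "complex set" where
  "slit_plane = - (complex_of_real ` {1..})"

text \<open>
  The value at \<open>z\<close> of the analytic continuation of the Gauss series to the slit plane. The
  continuation is unique on the slit plane only, so the description selects its value at \<open>z\<close>
  rather than the function. The definition is meaningful for \<open>c \<notin> \<int>\<^sub>\<le>\<^sub>0\<close> and \<open>z \<in> slit_plane\<close>.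
\<close>
definition hyp2F1 :: "complex \<Rightarrow> complex \<Rightarrow> complex \<Rightarrow> complex \<Rightarrow> complex" where
  "hyp2F1 a b c z =
     (THE w. \<exists>f. f holomorphic_on slit_plane \<and>
                 (\<forall>u\<in>ball 0 1. f u = hyp2F1_series a b c u) \<and> f z = w)"

definition w1 :: "real \<Rightarrow> complex \<Rightarrow> complex \<Rightarrow> complex \<Rightarrow> complex" where
  "w1 x a b c = hyp2F1 a b c (of_real x)"

definition w2 :: "real \<Rightarrow> complex \<Rightarrow> complex \<Rightarrow> complex \<Rightarrow> complex" where
  "w2 x a b c = of_real \<bar>x\<bar> powr (1 - c) * hyp2F1 (a - c + 1) (b - c + 1) (2 - c) (of_real x)"

definition w3 :: "real \<Rightarrow> complex \<Rightarrow> complex \<Rightarrow> complex \<Rightarrow> complex" where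
  "w3 x a b c = of_real \<bar>x\<bar> powr (- a) * hyp2F1 a (a - c + 1) (a - b + 1) (of_real (inverse x))"

definition w4 :: "real \<Rightarrow> complex \<Rightarrow> complex \<Rightarrow> complex \<Rightarrow> complex" where
  "w4 x a b c = of_real \<bar>x\<bar> powr (- b) * hyp2F1 b (b - c + 1) (b - a + 1) (of_real (inverse x))"

definition w5 :: "real \<Rightarrow> complex \<Rightarrow> complex \<Rightarrow> complex \<Rightarrow> complex" where
  "w5 x a b c = hyp2F1 a b (a + b - c + 1) (of_real (1 - x))"

definition w6 :: "real \<Rightarrow> complex \<Rightarrow> complex \<Rightarrow> complex \<Rightarrow> complex" where
  "w6 x a b c = of_real \<bar>1 - x\<bar> powr (c - a - b) *
     hyp2F1 (c - a) (c - b) (c - a - b + 1) (of_real (1 - x))"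

text \<open>
  The Bochner integral of a non-integrable function is \<open>0\<close>, so the existence of the integral
  is part of the assertion that it has a given value.
\<close>
definition has_lebesgue_integral_on :: "(real \<Rightarrow> complex) \<Rightarrow> complex \<Rightarrow> real set \<Rightarrow> bool" where
  "has_lebesgue_integral_on f I S \<longleftrightarrow>
     set_integrable lborel S f \<and> (LINT y:S|lborel. f y) = I"

end

theory Submission
  imports Defs
begin

text \<open>
  The substitutions \<open>y = x t\<close>, \<open>y = x / t\<close> and \<open>y = 1 - (1 - x) t\<close> turn seven of the identities into
  integrals of \<open>F\<close> against the kernel \<open>t\<^sup>s\<^sup>-\<^sup>1 (1 - t)\<^sup>\<mu>\<^sup>-\<^sup>1\<close> on \<open>(0, 1)\<close>. Such an integral multiplies the
  \<open>n\<close>-th Taylor coefficient by \<open>B(s, \<mu>) (s)\<^sub>n / (s + \<mu>)\<^sub>n\<close> and is holomorphic on the slit plane, so the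
  identities hold on the unit disc by comparing coefficients and everywhere by analytic continuation.
  The weighted integrals of \<open>w\<^sub>5\<close> and \<open>w\<^sub>6\<close> are first simplified by Euler's transformation, which
  follows from the differential equation for formal power series.
  The remaining two identities (for \<open>w\<^sub>2\<close> and \<open>w\<^sub>5\<close> on a half line) are Weyl integrals of \<open>F(\<alpha>, \<beta>; \<gamma>; \<cdot>)\<close>.
  For \<open>Re \<gamma> > Re \<beta>\<close> insert the Euler integral and exchange the integrations; a contiguous relation
  then lowers \<open>\<gamma>\<close> step by step. The same scheme gives the continuation of the Gauss series.
\<close>

section \<open>Lebesgue integrals over sets of reals\<close>

text \<open>Integrability is part of every claim, so each evaluation carries it along with the
  value. In the double integrals, taking norms replaces complex exponents by their real parts, so
  the closed form at real parameters supplies its own majorant. The Gamma quotients come from B(s,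
  \<mu>) / Gamma(\<mu>) = Gamma(s) / Gamma(s + \<mu>). The method is decided by the parameters of F
  that the shift by \<mu> moves. If only one moves, the multiplier can cancel against it. In the two
  Weyl integrals all three move and the range is unbounded, so expansion in the disc is of no help.
  The Euler integral used there needs Re \<gamma> > Re \<beta>, which the hypotheses do not provide;
  the descent in \<gamma> takes finitely many algebraic steps and avoids analyticity in the
  parameters. The weight y^(c - 1) belongs to the singular point 0, whereas w5 and w6 are expanded
  at 1. Euler's transformation reconciles them because its exponent is exactly 1 - c.\<close>

lemma has_lebesgue_integral_on_cong:
  assumes "\<And>y. y \<in> S \<Longrightarrow> f y = g y"
  shows "has_lebesgue_integral_on f I S \<longleftrightarrow> has_lebesgue_integral_on g I S"
proof -
  have "(\<lambda>y. indicator S y *\<^sub>R f y) = (\<lambda>y. indicator S y *\<^sub>R g y)"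
    using assms by (auto simp: indicator_def fun_eq_iff)
  then show ?thesis
    by (simp add: has_lebesgue_integral_on_def set_integrable_def set_lebesgue_integral_def)
qed

lemma has_lebesgue_integral_on_add:
  assumes "has_lebesgue_integral_on f I S" "has_lebesgue_integral_on g J S"
  shows "has_lebesgue_integral_on (\<lambda>y. f y + g y) (I + J) S"
  using assms by (auto simp: has_lebesgue_integral_on_def set_integral_add)

lemma has_lebesgue_integral_on_mult:
  assumes "has_lebesgue_integral_on f I S"
  shows "has_lebesgue_integral_on (\<lambda>y. k * f y) (k * I) S"
  using assms by (auto simp: has_lebesgue_integral_on_def)

text \<open>Continuity on a Borel set makes the integrand extended by zero Borel measurable, so
  passing from \<open>lborel\<close> to its completion changes neither integrability nor value. This
  opens the way to the substitution rule for \<open>absolutely_integrable_on\<close>.\<close>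

lemma has_lebesgue_integral_on_iff_absolutely_integrable:
  assumes "S \<in> sets borel" "continuous_on S f"
  shows "has_lebesgue_integral_on f I S \<longleftrightarrow> f absolutely_integrable_on S \<and> integral S f = I"
proof -
  have m: "(\<lambda>x. indicator S x *\<^sub>R f x) \<in> borel_measurable lborel"
    using borel_measurable_continuous_on_indicator[OF assms] by simp
  have "set_integrable lborel S f \<longleftrightarrow> f absolutely_integrable_on S"
    unfolding set_integrable_def by (rule integrable_completion[OF m, symmetric])
  moreover have "(LINT y:S|lborel. f y) = integral S f" if "f absolutely_integrable_on S"
  proof -
    have "(LINT y:S|lborel. f y) = (LINT y:S|lebesgue. f y)"
      unfolding set_lebesgue_integral_def by (rule integral_completion[OF m, symmetric])
    then show ?thesis using set_lebesgue_integral_eq_integral(2)[OF that] by simp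
  qed
  ultimately show ?thesis unfolding has_lebesgue_integral_on_def by auto
qed

text \<open>The Jacobian enters as an absolute value, so the decreasing substitutions used below
  need no orientation signs. Integrability and value are transported together.\<close>

lemma has_lebesgue_integral_on_change_of_variables:
  fixes g :: "real \<Rightarrow> real"
  assumes S: "S \<in> sets borel" "g ` S \<in> sets borel" and f: "continuous_on (g ` S) f"
    and g: "\<And>t. t \<in> S \<Longrightarrow> (g has_field_derivative g' t) (at t within S)"
    and g': "continuous_on S g'" and inj: "inj_on g S"
    and int: "has_lebesgue_integral_on (\<lambda>t. of_real \<bar>g' t\<bar> * f (g t)) I S"
  shows "has_lebesgue_integral_on f I (g ` S)"
proof -
  have cg: "continuous_on S g"
    using g by (meson DERIV_continuous continuous_on_eq_continuous_within)
  have c: "continuous_on S (\<lambda>t. of_real \<bar>g' t\<bar> * f (g t))"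
    by (intro continuous_intros g' continuous_on_compose2[OF f cg]) auto
  have "(\<lambda>t. \<bar>g' t\<bar> *\<^sub>R f (g t)) absolutely_integrable_on S \<and> integral S (\<lambda>t. \<bar>g' t\<bar> *\<^sub>R f (g t)) = I"
    using int unfolding has_lebesgue_integral_on_iff_absolutely_integrable[OF S(1) c]
    by (simp add: scaleR_conv_of_real)
  then have "f absolutely_integrable_on g ` S \<and> integral (g ` S) f = I"
    using S(1) by (subst (asm) has_absolute_integral_change_of_variables_real[OF _ g inj]) auto
  then show ?thesis
    using has_lebesgue_integral_on_iff_absolutely_integrable[OF S(2) f] by blast
qed

text \<open>Integrability on the product comes from the iterated integral of norms. That integral is
  phrased with \<open>has_lebesgue_integral_on\<close> and \<open>of_real\<close> so that a complex
  closed form, taken at real parameters, can serve as \<open>N\<close>.\<close>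

lemma has_lebesgue_integral_on_Fubini:
  fixes f :: "real \<Rightarrow> real \<Rightarrow> complex"
  assumes S: "S \<in> sets borel" and T: "T \<in> sets borel"
    and f: "continuous_on (S \<times> T) (\<lambda>(s, t). f s t)"
    and N: "\<And>s. s \<in> S \<Longrightarrow> has_lebesgue_integral_on (\<lambda>t. of_real (norm (f s t))) (of_real (N s)) T"
    and int_N: "set_integrable lborel S N"
    and I: "\<And>s. s \<in> S \<Longrightarrow> (LINT t:T|lborel. f s t) = I s" and J: "\<And>t. t \<in> T \<Longrightarrow> (LINT s:S|lborel. f s t) = J t"
    and K: "(LINT s:S|lborel. I s) = K"
  shows "has_lebesgue_integral_on J K T"
proof -
  define F where "F = (\<lambda>(s, t). indicator (S \<times> T) (s, t) *\<^sub>R f s t)"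
  have "S \<times> T \<in> sets (borel :: (real \<times> real) measure)"
    using S T by (simp add: borel_prod[symmetric])
  then have "(\<lambda>p. indicator (S \<times> T) p *\<^sub>R (case p of (s, t) \<Rightarrow> f s t)) \<in> borel_measurable borel"
    by (rule borel_measurable_continuous_on_indicator[OF _ f])
  moreover have "F = (\<lambda>p. indicator (S \<times> T) p *\<^sub>R (case p of (s, t) \<Rightarrow> f s t))"
    by (auto simp: F_def fun_eq_iff)
  ultimately have Fm: "F \<in> borel_measurable (lborel \<Otimes>\<^sub>M lborel)"
    by (simp add: lborel_prod)
  have F_split: "F (s, t) = indicator S s *\<^sub>R indicator T t *\<^sub>R f s t"
    "F (s, t) = indicator T t *\<^sub>R indicator S s *\<^sub>R f s t" for s t
    by (auto simp: F_def indicator_def)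
  have normF: "(LINT t|lborel. norm (F (s, t))) = indicator S s *\<^sub>R N s" for s
  proof (cases "s \<in> S")
    case True
    have "(LINT t|lborel. complex_of_real (norm (F (s, t)))) = of_real (N s)"
      using N[OF True] True
      by (simp add: F_split has_lebesgue_integral_on_def set_lebesgue_integral_def scaleR_conv_of_real
          norm_mult)
    then show ?thesis using True by (simp only: integral_complex_of_real of_real_eq_iff) simp
  qed (simp add: F_split)
  have int1: "integrable lborel (\<lambda>t. F (s, t))" for s
  proof (cases "s \<in> S")
    case True
    have m: "(\<lambda>t. F (s, t)) \<in> borel_measurable lborel"
      using Fm by (rule measurable_Pair2) simp
    have "integrable lborel (\<lambda>t. complex_of_real (norm (F (s, t))))"
      using N[OF True] True
      by (simp add: F_split has_lebesgue_integral_on_def set_integrable_def scaleR_conv_of_real norm_mult)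
    then show ?thesis using m by (simp add: integrable_norm_iff complex_of_real_integrable_eq)
  qed (simp add: F_split)
  have Fint: "integrable (lborel \<Otimes>\<^sub>M lborel) F"
    using int_N int1 by (intro lborel_pair.Fubini_integrable Fm) (auto simp: normF set_integrable_def)
  have inner: "(LINT s|lborel. F (s, t)) = indicator T t *\<^sub>R J t" for t
    using J[of t] by (cases "t \<in> T") (auto simp: F_split set_lebesgue_integral_def)
  have inner': "(LINT t|lborel. F (s, t)) = indicator S s *\<^sub>R I s" for s
    using I[of s] by (cases "s \<in> S") (auto simp: F_split set_lebesgue_integral_def)
  have swap: "integrable (lborel \<Otimes>\<^sub>M lborel) (\<lambda>(t, s). F (s, t))"
    using lborel_pair.integrable_product_swap[OF Fint] by simp
  have "integrable lborel (\<lambda>t. LINT s|lborel. F (s, t))"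
    using lborel_pair.integrable_fst'[OF swap] by simp
  moreover have "(LINT t|lborel. LINT s|lborel. F (s, t)) = (LINT s|lborel. LINT t|lborel. F (s, t))"
    using lborel_pair.Fubini_integral[of "\<lambda>s t. F (s, t)"] Fint by simp
  ultimately show ?thesis
    using K by (simp add: has_lebesgue_integral_on_def set_integrable_def set_lebesgue_integral_def inner inner')
qed

section \<open>Gamma and Beta integrals with complex exponents\<close>

lemma of_real_powr_eq_exp: "x > 0 \<Longrightarrow> complex_of_real x powr z = exp (z * of_real (ln x))"
  by (simp add: powr_def Ln_of_real)

text \<open>The scale \<open>p\<close> is the point: the integral represents the power p^(-z), and
  both p = s and p = 1 + u occur below. It reduces to p = 1 by scaling t.\<close>

lemma has_lebesgue_integral_on_Gamma:
  assumes p: "p > 0" and z: "Re z > 0"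
  shows "has_lebesgue_integral_on (\<lambda>t. of_real t powr (z - 1) * of_real (exp (- (p * t))))
           (Gamma z * of_real p powr (- z)) {0<..}"
proof -
  have eq: "(*) (1/p) ` {0<..} = {0<..}"
  proof -
    have "x \<in> (*) (1/p) ` {0<..}" if "x > 0" for x
      by (rule image_eqI[of _ _ "p * x"]) (use p that in auto)
    then show ?thesis using p by auto
  qed
  have c: "continuous_on {0<..} (\<lambda>t. complex_of_real t powr (z - 1) * of_real (exp (- (p * t))))" for p
    by (auto intro!: continuous_intros)
  have "has_lebesgue_integral_on (\<lambda>t. of_real t powr (z - 1) * of_real (exp (- (1 * t)))) (Gamma z) {0<..}"
    using absolutely_integrable_Gamma_integral'[OF z] Gamma_integral_complex'[OF z]
    by (subst has_lebesgue_integral_on_iff_absolutely_integrable[OF _ c])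
       (auto simp: exp_minus field_simps has_integral_iff)
  then have "has_lebesgue_integral_on
      (\<lambda>t. of_real p powr (- z) * (of_real t powr (z - 1) * of_real (exp (- (1 * t)))))
      (of_real p powr (- z) * Gamma z) {0<..}"
    by (rule has_lebesgue_integral_on_mult)
  also have "?this \<longleftrightarrow> has_lebesgue_integral_on
      (\<lambda>t. of_real \<bar>1/p\<bar> * (of_real ((1/p) * t) powr (z - 1) * of_real (exp (- (p * ((1/p) * t))))))
      (of_real p powr (- z) * Gamma z) {0<..}"
  proof (intro has_lebesgue_integral_on_cong)
    fix t :: real assume t: "t \<in> {0<..}"
    have "complex_of_real (1/p * t) powr (z - 1) = of_real p powr (1 - z) * of_real t powr (z - 1)"
      using p t by (simp add: of_real_powr_eq_exp ln_mult ln_div algebra_simps flip: exp_add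
          del: of_real_mult of_real_divide)
    moreover have "complex_of_real p powr (1 - z) = of_real p * of_real p powr (- z)"
      using p powr_add[of "complex_of_real p" 1 "- z"] by simp
    ultimately show "of_real p powr (- z) * (of_real t powr (z - 1) * of_real (exp (- (1 * t)))) =
        of_real \<bar>1/p\<bar> * (of_real ((1/p) * t) powr (z - 1) * of_real (exp (- (p * ((1/p) * t)))))"
      using p by simp
  qed
  finally have "has_lebesgue_integral_on (\<lambda>t. of_real t powr (z - 1) * of_real (exp (- (p * t))))
      (of_real p powr (- z) * Gamma z) ((*) (1/p) ` {0<..})"
  proof (rule has_lebesgue_integral_on_change_of_variables[rotated -1])
    show "continuous_on ((*) (1/p) ` {0<..}) (\<lambda>t. complex_of_real t powr (z - 1) * of_real (exp (- (p * t))))"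
      unfolding eq by (rule c)
    show "((*) (1/p) has_real_derivative 1/p) (at t within {0<..})" for t
      by (auto intro!: derivative_eq_intros)
    show "(*) (1/p) ` {0<..} \<in> sets borel"
      unfolding eq by simp
  qed (use p in \<open>auto simp: inj_on_def\<close>)
  then show ?thesis unfolding eq by (simp only: mult.commute)
qed

lemma norm_of_real_powr: "x > 0 \<Longrightarrow> norm (complex_of_real x powr z) = x powr Re z"
  by (simp add: norm_powr_real_powr)

lemma of_real_of_real_powr: "x > 0 \<Longrightarrow> complex_of_real (x powr r) = of_real x powr of_real r"
  by (simp add: powr_of_real)

text \<open>Multiply by \<open>Gamma \<alpha>\<close> and expand \<open>Gamma \<alpha> (1 + u)\<^sup>-\<^sup>\<alpha>\<close> as a Gamma integral; Fubini turns the
  double integral into a product of Gamma integrals.\<close>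
lemma has_lebesgue_integral_on_Beta_half_line:
  assumes \<mu>: "Re \<mu> > 0" and \<alpha>: "Re \<alpha> > Re \<mu>"
  shows "has_lebesgue_integral_on (\<lambda>u. of_real (1 + u) powr (- \<alpha>) * of_real u powr (\<mu> - 1))
           (Beta \<mu> (\<alpha> - \<mu>)) {0<..}"
proof -
  define f where "f \<alpha> \<mu> s u = of_real s powr (\<alpha> - 1) * of_real (exp (- (1 * s))) *
    (of_real u powr (\<mu> - 1) * of_real (exp (- (s * u))))" for \<alpha> \<mu> :: complex and s u
  have int_u: "has_lebesgue_integral_on (\<lambda>u. f \<alpha> \<mu> s u)
      (Gamma \<mu> * (of_real s powr (\<alpha> - \<mu> - 1) * of_real (exp (- (1 * s))))) {0<..}"
    if "s \<in> {0<..}" "Re \<mu> > 0" for s \<alpha> \<mu>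
  proof -
    have "of_real s powr (\<alpha> - \<mu> - 1) = complex_of_real s powr (\<alpha> - 1) * of_real s powr (- \<mu>)"
      by (simp add: algebra_simps flip: powr_add)
    then show ?thesis
      using has_lebesgue_integral_on_mult[OF has_lebesgue_integral_on_Gamma[of s \<mu>],
          of "of_real s powr (\<alpha> - 1) * of_real (exp (- (1 * s)))"] that
      by (simp add: f_def mult_ac)
  qed
  \<comment> \<open>Combining exp(-s) with exp(-s u) gives a Gamma integral of scale 1 + u.\<close>
  have int_s: "(LINT s:{0<..}|lborel. f \<alpha> \<mu> s u) =
      Gamma \<alpha> * (of_real (1 + u) powr (- \<alpha>) * of_real u powr (\<mu> - 1))" if "u \<in> {0<..}" for u
  proof -
    have "has_lebesgue_integral_on (\<lambda>s. of_real u powr (\<mu> - 1) *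
            (of_real s powr (\<alpha> - 1) * of_real (exp (- ((1 + u) * s)))))
        (of_real u powr (\<mu> - 1) * (Gamma \<alpha> * of_real (1 + u) powr (- \<alpha>))) {0<..}"
      using that \<mu> \<alpha>
      by (intro has_lebesgue_integral_on_mult has_lebesgue_integral_on_Gamma) auto
    also have "(\<lambda>s. of_real u powr (\<mu> - 1) *
            (of_real s powr (\<alpha> - 1) * of_real (exp (- ((1 + u) * s))))) = (\<lambda>s. f \<alpha> \<mu> s u)"
      by (auto simp: f_def algebra_simps exp_diff exp_minus exp_add fun_eq_iff divide_inverse)
    finally show ?thesis
      by (simp add: has_lebesgue_integral_on_def mult_ac)
  qed
  \<comment> \<open>Since \<open>s\<close> and \<open>u\<close> are positive, the norm only replaces
    exponents by their real parts, so \<open>int_u\<close> at the real parts evaluates the norm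
    integral too.\<close>
  have norm_f: "complex_of_real (norm (f \<alpha> \<mu> s u)) = f (of_real (Re \<alpha>)) (of_real (Re \<mu>)) s u"
    if "s \<in> {0<..}" "u \<in> {0<..}" for s u
    using that by (simp add: f_def norm_mult norm_of_real_powr of_real_of_real_powr)
  define N where "N s = Gamma (Re \<mu>) * (s powr (Re \<alpha> - Re \<mu> - 1) * exp (- (1 * s)))" for s
  have N: "has_lebesgue_integral_on (\<lambda>u. of_real (norm (f \<alpha> \<mu> s u))) (of_real (N s)) {0<..}"
    if s: "s \<in> {0<..}" for s
  proof -
    have "has_lebesgue_integral_on (\<lambda>u. f (of_real (Re \<alpha>)) (of_real (Re \<mu>)) s u) (of_real (N s)) {0<..}"
      using int_u[OF s, of "of_real (Re \<mu>)" "of_real (Re \<alpha>)"] \<mu> s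
      by (simp add: N_def of_real_of_real_powr Gamma_complex_of_real)
    then show ?thesis
      using norm_f[OF s] by (subst has_lebesgue_integral_on_cong) auto
  qed
  have gam: "has_lebesgue_integral_on (\<lambda>s. of_real s powr (\<alpha> - \<mu> - 1) * of_real (exp (- (1 * s))))
      (Gamma (\<alpha> - \<mu>)) {0<..}" if "Re (\<alpha> - \<mu>) > 0" for \<alpha> \<mu>
    using has_lebesgue_integral_on_Gamma[of 1 "\<alpha> - \<mu>"] that by simp
  have int_N: "set_integrable lborel {0<..} N"
  proof -
    have "has_lebesgue_integral_on (\<lambda>s. of_real (N s)) (of_real (Gamma (Re \<mu>)) * Gamma (of_real (Re \<alpha>) - of_real (Re \<mu>))) {0<..}"
      using has_lebesgue_integral_on_mult[OF gam[of "of_real (Re \<alpha>)" "of_real (Re \<mu>)"], of "of_real (Gamma (Re \<mu>))"] \<alpha>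
      by (subst has_lebesgue_integral_on_cong) (auto simp: N_def of_real_of_real_powr)
    then have "integrable lborel (\<lambda>x. complex_of_real (indicat_real {0<..} x *\<^sub>R N x))"
      by (simp add: has_lebesgue_integral_on_def set_integrable_def scaleR_conv_of_real)
    then show ?thesis unfolding set_integrable_def by (simp only: complex_of_real_integrable_eq)
  qed
  have "has_lebesgue_integral_on (\<lambda>u. Gamma \<alpha> * (of_real (1 + u) powr (- \<alpha>) * of_real u powr (\<mu> - 1)))
      (Gamma \<mu> * Gamma (\<alpha> - \<mu>)) {0<..}"
  proof (rule has_lebesgue_integral_on_Fubini[where S = "{0<..}" and f = "f \<alpha> \<mu>" and N = N])
    show "continuous_on ({0<..} \<times> {0<..}) (\<lambda>(s, t). f \<alpha> \<mu> s t)"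
      unfolding f_def by (auto intro!: continuous_intros simp: case_prod_unfold)
    show "(LINT s:{0<..}|lborel. Gamma \<mu> * (of_real s powr (\<alpha> - \<mu> - 1) * of_real (exp (- (1 * s))))) =
        Gamma \<mu> * Gamma (\<alpha> - \<mu>)"
      using gam[of \<alpha> \<mu>] \<alpha> by (simp add: has_lebesgue_integral_on_def)
    show "(LINT u:{0<..}|lborel. f \<alpha> \<mu> s u) =
        Gamma \<mu> * (of_real s powr (\<alpha> - \<mu> - 1) * of_real (exp (- (1 * s))))" if "s \<in> {0<..}" for s
      using int_u[OF that \<mu>] unfolding has_lebesgue_integral_on_def by blast
  qed (use int_s N int_N in auto)
  from has_lebesgue_integral_on_mult[OF this, of "inverse (Gamma \<alpha>)"]
  have "has_lebesgue_integral_on (\<lambda>u. inverse (Gamma \<alpha>) * (Gamma \<alpha> * (of_real (1 + u) powr (- \<alpha>) * of_real u powr (\<mu> - 1))))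
      (inverse (Gamma \<alpha>) * (Gamma \<mu> * Gamma (\<alpha> - \<mu>))) {0<..}" .
  moreover have "Gamma \<alpha> \<noteq> 0"
    using \<alpha> \<mu> by (auto simp: Gamma_eq_zero_iff elim!: nonpos_Ints_cases)
  ultimately show ?thesis
    by (simp add: Beta_def field_simps)
qed

text \<open>The map u -> u / (1 + u) carries the half line onto the unit interval. Then 1 - t = 1 /
  (1 + u), and with the Jacobian 1 / (1 + u)^2 the powers of 1 + u add up to -(s + \<mu>).\<close>

lemma has_lebesgue_integral_on_Beta:
  assumes s: "Re s > 0" and \<mu>: "Re \<mu> > 0"
  shows "has_lebesgue_integral_on (\<lambda>t. of_real t powr (s - 1) * of_real (1 - t) powr (\<mu> - 1))
           (Beta s \<mu>) {0<..<1}"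
proof -
  define g where "g u = u / (1 + u)" for u :: real
  have eq: "g ` {0<..} = {0<..<1}"
  proof -
    have "x \<in> g ` {0<..}" if "0 < x" "x < 1" for x
      by (rule image_eqI[of _ _ "x / (1 - x)"]) (use that in \<open>auto simp: g_def field_simps\<close>)
    then show ?thesis by (auto simp: g_def)
  qed
  have "has_lebesgue_integral_on (\<lambda>t. of_real t powr (s - 1) * of_real (1 - t) powr (\<mu> - 1))
           (Beta s \<mu>) (g ` {0<..})"
  proof (rule has_lebesgue_integral_on_change_of_variables[where g' = "\<lambda>u. 1 / (1 + u)^2"])
    show "continuous_on (g ` {0<..}) (\<lambda>t. complex_of_real t powr (s - 1) * of_real (1 - t) powr (\<mu> - 1))"
      unfolding eq by (intro continuous_intros) (auto simp: complex_nonpos_Reals_iff)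
    show "has_lebesgue_integral_on (\<lambda>u. of_real \<bar>1 / (1 + u)^2\<bar> *
        (of_real (g u) powr (s - 1) * of_real (1 - g u) powr (\<mu> - 1))) (Beta s \<mu>) {0<..}"
    proof (subst has_lebesgue_integral_on_cong)
      show "has_lebesgue_integral_on (\<lambda>u. of_real (1 + u) powr (- (s + \<mu>)) * of_real u powr (s - 1))
           (Beta s \<mu>) {0<..}"
        using has_lebesgue_integral_on_Beta_half_line[OF s, of "s + \<mu>"] \<mu> by simp
      fix u :: real assume u: "u \<in> {0<..}"
      \<comment> \<open>Every factor becomes an exponential of ln u and ln (1 + u), which leaves a
        linear identity between exponents.\<close>
      have "1 - g u = 1 / (1 + u)" using u by (simp add: g_def field_simps)
      moreover have "of_real (1 / (1 + u)) powr (\<mu> - 1) = exp ((1 - \<mu>) * of_real (ln (1 + u)))"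
        using u by (simp add: of_real_powr_eq_exp ln_div algebra_simps del: of_real_divide of_real_add)
      moreover have "of_real (g u) powr (s - 1) = exp ((s - 1) * (of_real (ln u) - of_real (ln (1 + u))))"
        using u by (simp add: g_def of_real_powr_eq_exp ln_div algebra_simps
          del: of_real_mult of_real_divide of_real_add)
      moreover have "complex_of_real \<bar>1 / (1 + u)^2\<bar> = exp (- 2 * of_real (ln (1 + u)))"
      proof -
        have "exp (- 2 * complex_of_real (ln (1 + u))) = of_real (exp (- (2 * ln (1 + u))))"
          by (simp flip: exp_of_real)
        also have "exp (- (2 * ln (1 + u))) = 1 / (1 + u)^2"
          using u by (simp add: exp_minus exp_double divide_inverse)
        finally show ?thesis by simp
      qed
      ultimately show "of_real \<bar>1 / (1 + u)^2\<bar> *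
        (of_real (g u) powr (s - 1) * of_real (1 - g u) powr (\<mu> - 1)) =
        of_real (1 + u) powr (- (s + \<mu>)) * of_real u powr (s - 1)"
        using u by (simp only: mult_exp_exp) (simp add: of_real_powr_eq_exp mult_exp_exp algebra_simps
          del: of_real_mult of_real_divide of_real_add)
    qed
    show "(g has_real_derivative 1 / (1 + t)^2) (at t within {0<..})" if "t \<in> {0<..}" for t
      using that unfolding g_def by (auto intro!: derivative_eq_intros simp: power2_eq_square field_simps)
    show "inj_on g {0<..}"
      by (rule inj_on_inverseI[of _ "\<lambda>t. t / (1 - t)"]) (auto simp: g_def field_simps)
  qed (auto simp: eq intro!: continuous_intros)
  then show ?thesis by (simp add: eq)
qed

section \<open>Scaled integrals of holomorphic functions on the slit plane\<close>

lemma slit_plane_iff: "z \<in> slit_plane \<longleftrightarrow> Im z \<noteq> 0 \<or> Re z < 1"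
proof -
  have "z \<in> complex_of_real ` {1..} \<longleftrightarrow> Im z = 0 \<and> Re z \<ge> 1"
    by (auto simp: image_iff complex_eq_iff)
  then show ?thesis by (auto simp: slit_plane_def)
qed

lemma open_slit_plane: "open slit_plane"
proof -
  have "closed {z. Im z = 0 \<and> Re z \<ge> 1}"
    by (intro closed_Collect_conj closed_Collect_eq closed_Collect_le continuous_intros)
  moreover have "slit_plane = - {z. Im z = 0 \<and> Re z \<ge> 1}"
    by (auto simp: slit_plane_iff)
  ultimately show ?thesis using open_Compl by metis
qed

text \<open>This is starlikeness about 0: it keeps G (t z) meaningful for all t in the integral and
  also yields connectedness.\<close>

lemma scale_slit_plane:
  assumes "z \<in> slit_plane" "0 \<le> t" "t \<le> 1"
  shows "of_real t * z \<in> slit_plane"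
proof (cases "t = 0 \<or> Im z \<noteq> 0")
  case False
  then have "Re z < 1" using assms by (auto simp: slit_plane_iff)
  then have "t * Re z < 1"
    using mult_strict_left_mono[of "Re z" 1 t] \<open>Re z < 1\<close> assms(2,3) False by linarith
  then show ?thesis by (auto simp: slit_plane_iff)
qed (auto simp: slit_plane_iff)

lemma of_real_slit_plane: "x < 1 \<Longrightarrow> of_real x \<in> slit_plane"
  by (auto simp: slit_plane_iff)

lemma ball_subset_slit_plane: "ball 0 1 \<subseteq> slit_plane"
proof
  fix z :: complex assume "z \<in> ball 0 1"
  then have "Re z < 1" using complex_Re_le_cmod[of z] by simp
  then show "z \<in> slit_plane" by (simp add: slit_plane_iff)
qed

lemma connected_slit_plane: "connected slit_plane"
proof -
  have "closed_segment 0 z \<subseteq> slit_plane" if "z \<in> slit_plane" for z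
    using scale_slit_plane[OF that] by (auto simp: closed_segment_def scaleR_conv_of_real)
  then have "starlike slit_plane"
    unfolding starlike_def by (intro bexI[of _ 0]) (auto simp: slit_plane_iff)
  then show ?thesis by (rule starlike_imp_connected)
qed

lemma holomorphic_slit_plane_eqI:
  assumes "f holomorphic_on slit_plane" "g holomorphic_on slit_plane"
    and "\<And>u. u \<in> ball 0 1 \<Longrightarrow> f u = g u" and "z \<in> slit_plane"
  shows "f z = g z"
  using analytic_continuation_open[of "ball 0 1" slit_plane f g z] assms
    ball_subset_slit_plane open_slit_plane connected_slit_plane by auto

text \<open>The kernel \<open>k\<close> may be unbounded near the endpoints, so it enters through
  integrability alone. The geometric bound, uniform in t, makes the sums of norms converge both
  pointwise and after integration, which justifies integrating term by term.\<close>

lemma set_integral_dominated_series: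
  fixes k :: "real \<Rightarrow> complex" and h :: "nat \<Rightarrow> real \<Rightarrow> complex"
  assumes k: "set_integrable lborel S k" and S: "S \<in> sets borel"
    and h: "\<And>n. continuous_on S (h n)" and q: "0 \<le> q" "q < 1"
    and bound: "\<And>n t. t \<in> S \<Longrightarrow> norm (h n t) \<le> M * q ^ n"
    and sums: "\<And>t. t \<in> S \<Longrightarrow> (\<lambda>n. h n t) sums F t"
  shows "set_integrable lborel S (\<lambda>t. k t * F t)"
    and "(\<lambda>n. LINT t:S|lborel. k t * h n t) sums (LINT t:S|lborel. k t * F t)"
proof -
  define f where "f n t = indicator S t *\<^sub>R (k t * h n t)" for n t
  have f_alt: "f n t = (indicator S t *\<^sub>R k t) * (indicator S t *\<^sub>R h n t)" for n t
    by (auto simp: f_def indicator_def)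
  have ki: "integrable lborel (\<lambda>t. indicator S t *\<^sub>R k t)"
    using k by (simp add: set_integrable_def)
  have f_bound: "norm (f n t) \<le> norm (indicator S t *\<^sub>R k t) * (M * q ^ n)" for n t
    using bound[of t n] by (auto simp: f_def norm_mult indicator_def intro!: mult_left_mono)
  have bi: "integrable lborel (\<lambda>t. norm (indicator S t *\<^sub>R k t) * (M * q ^ n))" for n
    by (intro integrable_mult_left integrable_norm ki)
  have fm: "f n \<in> borel_measurable lborel" for n
  proof -
    have "(\<lambda>t. indicator S t *\<^sub>R h n t) \<in> borel_measurable borel"
      by (rule borel_measurable_continuous_on_indicator[OF S h])
    then show ?thesis unfolding f_alt[abs_def]
      using borel_measurable_integrable[OF ki] by (intro borel_measurable_times) simp_all
  qed
  have fi: "integrable lborel (f n)" for n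
  proof (rule Bochner_Integration.integrable_bound[OF bi[of n] fm AE_I2])
    show "norm (f n t) \<le> norm (norm (indicator S t *\<^sub>R k t) * (M * q ^ n))" for t
      using f_bound[of n t] by simp
  qed
  have geo: "summable (\<lambda>n. x * (M * q ^ n))" for x
    using q by (intro summable_mult summable_geometric) auto
  have s1: "summable (\<lambda>n. norm (f n t))" for t
    using f_bound by (intro summable_comparison_test'[OF geo]) simp
  have s2: "summable (\<lambda>n. LINT t|lborel. norm (f n t))"
  proof (rule summable_comparison_test'[OF geo])
    fix n :: nat
    have "(LINT t|lborel. norm (f n t)) \<le> (LINT t|lborel. norm (indicator S t *\<^sub>R k t) * (M * q ^ n))"
      using f_bound by (intro integral_mono integrable_norm fi bi) auto
    then show "norm (LINT t|lborel. norm (f n t)) \<le> (LINT t|lborel. norm (indicator S t *\<^sub>R k t)) * (M * q ^ n)"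
      by simp
  qed
  have F: "(\<Sum>n. f n t) = indicator S t *\<^sub>R (k t * F t)" for t
    using sums[of t] by (cases "t \<in> S") (auto simp: f_def sums_iff suminf_mult)
  show "set_integrable lborel S (\<lambda>t. k t * F t)"
    using integrable_suminf[OF fi _ s2] s1 by (simp add: F set_integrable_def)
  show "(\<lambda>n. LINT t:S|lborel. k t * h n t) sums (LINT t:S|lborel. k t * F t)"
    using sums_integral[OF fi _ s2] s1 unfolding F unfolding set_lebesgue_integral_def f_def by simp
qed

text \<open>The segment from 0 to z is compact in the open slit plane, so a closed tube of fixed
  radius around it stays inside, and G is bounded on that compact tube. Radius and bound are thus
  independent of t.\<close>

lemma slit_plane_uniform_nbhd:
  assumes z: "z \<in> slit_plane" and G: "continuous_on slit_plane G"
  obtains \<delta> M where "\<delta> > 0" "\<And>t. t \<in> {0<..<1} \<Longrightarrow> cball (of_real t * z) \<delta> \<subseteq> slit_plane"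
    "\<And>t u. t \<in> {0<..<1} \<Longrightarrow> u \<in> cball (of_real t * z) \<delta> \<Longrightarrow> norm (G u :: complex) \<le> M"
proof -
  define K where "K = closed_segment 0 z"
  have "compact K" by (simp add: K_def)
  moreover have "K \<subseteq> slit_plane"
    using scale_slit_plane[OF z] by (auto simp: K_def closed_segment_def scaleR_conv_of_real)
  ultimately have K: "compact K" "K \<subseteq> slit_plane" .
  obtain \<delta> where \<delta>: "\<delta> > 0" "{x + y | x y. x \<in> K \<and> y \<in> cball 0 \<delta>} \<subseteq> slit_plane"
  proof -
    obtain e where e: "e > 0" "(\<Union>x\<in>K. cball x e) \<subseteq> slit_plane"
      by (rule compact_subset_open_imp_cball_epsilon_subset[OF K(1) open_slit_plane K(2)])
    have "x + y \<in> cball x e" if "y \<in> cball 0 e" for x y :: complex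
      using that by (simp add: dist_norm)
    then have "{x + y | x y. x \<in> K \<and> y \<in> cball 0 e} \<subseteq> slit_plane" using e(2) by blast
    then show ?thesis using that e(1) by blast
  qed
  define C where "C = {x + y | x y. x \<in> K \<and> y \<in> cball 0 \<delta>}"
  have "compact C"
    unfolding C_def by (intro compact_sums K(1) compact_cball)
  then have "bounded (G ` C)"
    using \<delta>(2) G by (intro compact_imp_bounded compact_continuous_image) (auto simp: C_def intro: continuous_on_subset)
  then obtain M where M: "\<And>u. u \<in> C \<Longrightarrow> norm (G u) \<le> M"
    by (auto simp: bounded_iff)
  have sub: "cball (of_real t * z) \<delta> \<subseteq> C" if "t \<in> {0<..<1}" for t
  proof
    fix u assume "u \<in> cball (of_real t * z) \<delta>"
    then have "u - of_real t * z \<in> cball 0 \<delta>" by (simp add: dist_norm norm_minus_commute)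
    moreover have "of_real t * z \<in> K"
      using that by (auto simp: K_def closed_segment_def scaleR_conv_of_real intro!: exI[of _ t])
    moreover have "u = of_real t * z + (u - of_real t * z)" by simp
    ultimately show "u \<in> C" unfolding C_def by blast
  qed
  show ?thesis using that[OF \<delta>(1), of M] sub \<delta>(2) M unfolding C_def by blast
qed

text \<open>Near each z the Taylor expansion of w -> G (t w) is integrated term by term. One radius
  and one bound serve all t, so the integral is itself a convergent power series around z; the same
  domination gives integrability.\<close>

lemma
  assumes k: "set_integrable lborel {0<..<1} k" and G: "G holomorphic_on slit_plane"
  shows set_integrable_mult_holomorphic:
      "\<And>z. z \<in> slit_plane \<Longrightarrow> set_integrable lborel {0<..<1} (\<lambda>t. k t * G (of_real t * z))"
    and holomorphic_on_set_integral_scaled: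
      "(\<lambda>z. LINT t:{0<..<1}|lborel. k t * G (of_real t * z)) holomorphic_on slit_plane"
proof -
  define H where "H z = (LINT t:{0<..<1}|lborel. k t * G (of_real t * z))" for z
  have cG: "continuous_on slit_plane G"
    using G by (rule holomorphic_on_imp_continuous_on)
  have *: "\<exists>\<delta>>0. (\<forall>w\<in>ball z \<delta>. set_integrable lborel {0<..<1} (\<lambda>t. k t * G (of_real t * w))) \<and>
      H holomorphic_on ball z \<delta>" if z: "z \<in> slit_plane" for z
  proof -
    obtain \<delta> M where \<delta>: "\<delta> > 0" "\<And>t. t \<in> {0<..<1} \<Longrightarrow> cball (of_real t * z) \<delta> \<subseteq> slit_plane"
      "\<And>t u. t \<in> {0<..<1} \<Longrightarrow> u \<in> cball (of_real t * z) \<delta> \<Longrightarrow> norm (G u) \<le> M"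
      using slit_plane_uniform_nbhd[OF z cG] by metis
    \<comment> \<open>Taylor coefficients of w -> G (t w) at z; the chain rule contributes
      t^n.\<close>
    define c where "c n t = of_real t ^ n * ((deriv ^^ n) G (of_real t * z) / fact n)" for n and t :: real
    have c_cont: "continuous_on {0<..<1} (c n)" for n
    proof -
      have "continuous_on slit_plane ((deriv ^^ n) G)"
        by (intro holomorphic_on_imp_continuous_on holomorphic_higher_deriv G open_slit_plane)
      then have "continuous_on {0<..<1} (\<lambda>t. (deriv ^^ n) G (of_real t * z))"
        by (rule continuous_on_compose2) (auto intro!: continuous_intros scale_slit_plane z)
      then show ?thesis unfolding c_def by (intro continuous_intros) auto
    qed
    \<comment> \<open>Cauchy's inequality on the disc of radius \<delta> around t z; the factor t^n
      is at most 1.\<close>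
    have c_bound: "norm (c n t) \<le> M / \<delta> ^ n" if t: "t \<in> {0<..<1}" for n t
    proof -
      have "norm ((deriv ^^ n) G (of_real t * z)) \<le> fact n * M / \<delta> ^ n"
      proof (rule Cauchy_inequality)
        show "G holomorphic_on ball (of_real t * z) \<delta>"
          using G \<delta>(2)[OF t] ball_subset_cball by (meson holomorphic_on_subset order_trans)
        show "continuous_on (cball (of_real t * z) \<delta>) G"
          using cG \<delta>(2)[OF t] by (rule continuous_on_subset)
        show "norm (G x) \<le> M" if "norm (of_real t * z - x) = \<delta>" for x
          using \<delta>(3)[OF t, of x] that by (simp add: dist_norm)
      qed (rule \<delta>(1))
      then have d: "norm ((deriv ^^ n) G (of_real t * z) / fact n) \<le> M / \<delta> ^ n"
        by (simp add: norm_divide field_simps)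
      have "norm (c n t) = t ^ n * norm ((deriv ^^ n) G (of_real t * z) / fact n)"
        using t by (simp add: c_def norm_mult norm_power norm_divide)
      also have "\<dots> \<le> 1 * (M / \<delta> ^ n)"
        using t by (intro mult_mono d) (auto intro: power_le_one)
      finally show ?thesis by simp
    qed
    have ser: "set_integrable lborel {0<..<1} (\<lambda>t. k t * G (of_real t * w)) \<and>
       (\<lambda>n. (LINT t:{0<..<1}|lborel. k t * c n t) * (w - z) ^ n) sums H w" if w: "w \<in> ball z \<delta>" for w
    proof -
      have q: "0 \<le> norm (w - z) / \<delta>" "norm (w - z) / \<delta> < 1"
        using w \<delta>(1) by (auto simp: dist_norm norm_minus_commute)
      have b: "norm (c n t * (w - z) ^ n) \<le> M * (norm (w - z) / \<delta>) ^ n" if "t \<in> {0<..<1}" for n t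
        using mult_right_mono[OF c_bound[OF that, of n], of "norm (w - z) ^ n"]
        by (simp add: norm_mult norm_power power_divide)
      have s: "(\<lambda>n. c n t * (w - z) ^ n) sums G (of_real t * w)" if t: "t \<in> {0<..<1}" for t
      proof -
        have hol: "G holomorphic_on ball (of_real t * z) \<delta>"
          using G \<delta>(2)[OF t] ball_subset_cball by (meson holomorphic_on_subset order_trans)
        have "norm (of_real t * (w - z)) \<le> 1 * norm (w - z)"
          unfolding norm_mult using t by (intro mult_right_mono) auto
        then have "of_real t * w \<in> ball (of_real t * z) \<delta>"
          using w by (simp add: dist_norm norm_minus_commute algebra_simps)
        from holomorphic_power_series[OF hol this]
        have "(\<lambda>n. (deriv ^^ n) G (of_real t * z) / fact n * (of_real t * w - of_real t * z) ^ n) sums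
          G (of_real t * w)" .
        moreover have "of_real t * w - of_real t * z = of_real t * (w - z)" by (simp add: algebra_simps)
        ultimately show ?thesis by (simp add: c_def power_mult_distrib mult_ac)
      qed
      note D = set_integral_dominated_series[OF k _ _ q b s]
      have "set_integrable lborel {0<..<1} (\<lambda>t. k t * G (of_real t * w))"
        by (rule D(1)) (auto intro!: continuous_intros c_cont)
      moreover have "(\<lambda>n. LINT t:{0<..<1}|lborel. k t * (c n t * (w - z) ^ n)) sums H w"
        unfolding H_def by (rule D(2)) (auto intro!: continuous_intros c_cont)
      moreover have "(LINT t:{0<..<1}|lborel. k t * (c n t * (w - z) ^ n)) =
          (LINT t:{0<..<1}|lborel. k t * c n t) * (w - z) ^ n" for n
        by (simp only: mult.assoc[symmetric] set_integral_mult_left)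
      ultimately show ?thesis by simp
    qed
    then have "H holomorphic_on ball z \<delta>"
      by (intro power_series_holomorphic[where a = "\<lambda>n. LINT t:{0<..<1}|lborel. k t * c n t"]) blast
    then show ?thesis using \<delta>(1) ser by blast
  qed
  show "set_integrable lborel {0<..<1} (\<lambda>t. k t * G (of_real t * z))" if "z \<in> slit_plane" for z
    using *[OF that] by force
  have "H analytic_on slit_plane"
    unfolding analytic_on_def using * by blast
  then show "(\<lambda>z. LINT t:{0<..<1}|lborel. k t * G (of_real t * z)) holomorphic_on slit_plane"
    unfolding H_def by (rule analytic_imp_holomorphic)
qed

lemma set_integral_scaled_power_series:
  fixes k :: "real \<Rightarrow> complex" and g :: "nat \<Rightarrow> complex"
  assumes k: "set_integrable lborel {0<..<1} k"
    and G: "\<And>u. u \<in> ball 0 1 \<Longrightarrow> (\<lambda>n. g n * u ^ n) sums G u" and z: "z \<in> ball 0 1"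
  shows "(\<lambda>n. (LINT t:{0<..<1}|lborel. k t * of_real t ^ n) * g n * z ^ n) sums
    (LINT t:{0<..<1}|lborel. k t * G (of_real t * z))"
proof -
  \<comment> \<open>The terms at the radius \<open>r\<close> are bounded, so |z| / r serves as the
    geometric ratio, uniformly in t.\<close>
  obtain r where r: "norm z < r" "r < 1" using z dense by auto
  have "r > 0" using r norm_ge_zero[of z] by linarith
  have "summable (\<lambda>n. g n * of_real r ^ n)"
    using G[of "of_real r"] r \<open>r > 0\<close> by (auto simp: sums_iff)
  then have "(\<lambda>n. g n * of_real r ^ n) \<longlonglongrightarrow> 0" by (rule summable_LIMSEQ_zero)
  then have "Bseq (\<lambda>n. g n * of_real r ^ n)"
    by (intro convergent_imp_Bseq convergentI)
  then obtain M where M: "\<And>n. norm (g n * of_real r ^ n) \<le> M"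
    unfolding Bseq_def by blast
  have "(\<lambda>n. LINT t:{0<..<1}|lborel. k t * (g n * (of_real t * z) ^ n)) sums
    (LINT t:{0<..<1}|lborel. k t * G (of_real t * z))"
  proof (rule set_integral_dominated_series(2)[OF k])
    show "0 \<le> norm z / r" "norm z / r < 1" using r \<open>r > 0\<close> by auto
    fix t :: real assume t: "t \<in> {0<..<1}"
    have tz: "norm (of_real t * z) \<le> norm z"
      using t by (simp add: norm_mult mult_left_le_one_le)
    show "(\<lambda>n. g n * (of_real t * z) ^ n) sums G (of_real t * z)"
      using tz z by (intro G) (auto intro: le_less_trans)
    fix n
    have "norm (g n * (of_real t * z) ^ n) \<le> norm (g n) * norm z ^ n"
      unfolding norm_mult[of "g n"] norm_power using tz by (intro mult_left_mono power_mono) auto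
    also have "\<dots> = norm (g n * of_real r ^ n) * (norm z / r) ^ n"
      using \<open>r > 0\<close> by (simp add: norm_mult norm_power power_divide)
    also have "\<dots> \<le> M * (norm z / r) ^ n"
      using \<open>r > 0\<close> by (intro mult_right_mono M) auto
    finally show "norm (g n * (of_real t * z) ^ n) \<le> M * (norm z / r) ^ n" .
  qed (auto intro!: continuous_intros)
  moreover have "(LINT t:{0<..<1}|lborel. k t * (g n * (of_real t * z) ^ n)) =
      (LINT t:{0<..<1}|lborel. k t * of_real t ^ n) * g n * z ^ n" for n
  proof -
    have "k t * (g n * (of_real t * z) ^ n) = (k t * of_real t ^ n) * (g n * z ^ n)" for t
      by (simp add: power_mult_distrib mult_ac)
    then show ?thesis by (simp only: set_integral_mult_left) (simp only: mult.assoc)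
  qed
  ultimately show ?thesis by simp
qed

section \<open>The Gauss series and its contiguous relations\<close>

text \<open>As a formal series, so that contiguous relations and the differential equation become
  coefficient identities and convergence is treated once.\<close>

definition fps_2F1 :: "complex \<Rightarrow> complex \<Rightarrow> complex \<Rightarrow> complex fps" where
  "fps_2F1 a b c = Abs_fps (\<lambda>n. pochhammer a n * pochhammer b n / (pochhammer c n * fact n))"

lemma hyp2F1_series_eq_eval_fps: "hyp2F1_series a b c z = eval_fps (fps_2F1 a b c) z"
  by (simp add: hyp2F1_series_def eval_fps_def fps_2F1_def)

lemma plus_of_nat_neq_0: "c \<notin> \<int>\<^sub>\<le>\<^sub>0 \<Longrightarrow> c + of_nat n \<noteq> (0 :: complex)"
  using plus_of_nat_eq_0_imp by blast

lemma not_nonpos_Int_plus_of_nat: "c \<notin> \<int>\<^sub>\<le>\<^sub>0 \<Longrightarrow> c + of_nat n \<notin> (\<int>\<^sub>\<le>\<^sub>0 :: complex set)"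
proof
  assume c: "c \<notin> \<int>\<^sub>\<le>\<^sub>0" and "c + of_nat n \<in> \<int>\<^sub>\<le>\<^sub>0"
  then obtain k where "c + of_nat n = - of_nat k" by (auto elim!: nonpos_Ints_cases')
  then have "c + of_nat (n + k) = - of_nat k + of_nat k" by (simp flip: add.assoc)
  then have "c + of_nat (n + k) = 0" by simp
  then show False using plus_of_nat_neq_0[OF c] by blast
qed

lemma pochhammer_not_nonpos_Int: "c \<notin> \<int>\<^sub>\<le>\<^sub>0 \<Longrightarrow> pochhammer c n \<noteq> (0 :: complex)"
  by (auto simp: pochhammer_eq_0_iff)

text \<open>Cleared of denominators, the recursion has the shape of the coefficients of the
  hypergeometric operator, so it can be matched with the differential equation directly.\<close>

lemma fps_2F1_nth_Suc:
  assumes "c \<notin> \<int>\<^sub>\<le>\<^sub>0"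
  shows "of_nat (Suc n) * (c + of_nat n) * fps_nth (fps_2F1 a b c) (Suc n) =
    (a + of_nat n) * (b + of_nat n) * fps_nth (fps_2F1 a b c) n"
proof -
  have "k * x * (A * u * (B * v) / (C * x * (k * F))) = u * v * (A * B / (C * F))"
    if "x \<noteq> 0" "k \<noteq> 0" for k x A B C F u v :: complex
    using that by (simp add: field_simps)
  from this[OF plus_of_nat_neq_0[OF assms] of_nat_neq_0, of n n] show ?thesis
    by (simp add: fps_2F1_def pochhammer_Suc del: of_nat_Suc)
qed

text \<open>The ratio of consecutive coefficients tends to 1. Only a lower bound is claimed because
  the series terminates when a or b is a nonpositive integer.\<close>

lemma fps_conv_radius_2F1:
  assumes c: "c \<notin> \<int>\<^sub>\<le>\<^sub>0"
  shows "fps_conv_radius (fps_2F1 a b c) \<ge> 1"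
  unfolding fps_conv_radius_def
proof (rule conv_radius_geI_ex)
  fix r :: real assume r: "0 < r" "ereal r < 1"
  define f where "f n = fps_nth (fps_2F1 a b c) n * of_real r ^ n" for n
  define R where "R n = (a + of_nat n) / (c + of_nat n) * ((b + of_nat n) / (1 + of_nat n)) * of_real r" for n
  have lim: "(\<lambda>n. (a + of_nat n) / (c + of_nat n)) \<longlonglongrightarrow> 1" if "c \<notin> \<int>\<^sub>\<le>\<^sub>0" for a c :: complex
  proof -
    have "(\<lambda>n. 1 + (a - c) / (c + of_nat n)) \<longlonglongrightarrow> 1 + 0"
      by (intro tendsto_intros tendsto_divide_0[OF tendsto_const]
          tendsto_add_filterlim_at_infinity[OF tendsto_const] tendsto_of_nat)
    moreover have "1 + (a - c) / (c + of_nat n) = (a + of_nat n) / (c + of_nat n)" for n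
      using plus_of_nat_neq_0[OF that, of n] by (simp add: field_simps)
    ultimately show ?thesis by simp
  qed
  have one: "(1 :: complex) \<notin> \<int>\<^sub>\<le>\<^sub>0" by simp
  have "(\<lambda>n. norm (R n)) \<longlonglongrightarrow> norm (1 * 1 * complex_of_real r)"
    unfolding R_def by (intro tendsto_intros lim c one)
  \<comment> \<open>The midpoint of r and 1 separates the limiting ratio r from 1, as the ratio test
    requires.\<close>
  moreover have "norm (1 * 1 * complex_of_real r) < (1 + r) / 2" using r by simp
  ultimately have "eventually (\<lambda>n. norm (R n) < (1 + r) / 2) sequentially"
    by (rule order_tendstoD(2))
  then obtain N where N: "\<And>n. n \<ge> N \<Longrightarrow> norm (R n) < (1 + r) / 2"
    by (auto simp: eventually_sequentially)
  have step: "f (Suc n) = R n * f n" for n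
  proof -
    have "of_nat (Suc n) * (c + of_nat n) \<noteq> (0 :: complex)"
      using plus_of_nat_neq_0[OF c] by (simp del: of_nat_Suc)
    then have "fps_nth (fps_2F1 a b c) (Suc n) =
        (a + of_nat n) * (b + of_nat n) / (of_nat (Suc n) * (c + of_nat n)) * fps_nth (fps_2F1 a b c) n"
      using fps_2F1_nth_Suc[OF c, of n a b] by (simp add: eq_divide_eq mult_ac del: of_nat_Suc)
    then show ?thesis by (simp add: f_def R_def mult_ac)
  qed
  have "summable f"
  proof (rule summable_ratio_test)
    show "(1 + r) / 2 < 1" using r by simp
    show "norm (f (Suc n)) \<le> (1 + r) / 2 * norm (f n)" if "n \<ge> N" for n
      unfolding step norm_mult using N[OF that] by (intro mult_right_mono) auto
  qed
  then show "\<exists>z. norm z = r \<and> summable (\<lambda>n. fps_nth (fps_2F1 a b c) n * z ^ n)"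
    using r by (intro exI[of _ "of_real r"]) (simp add: f_def[abs_def])
qed

lemma norm_less_fps_conv_radius_2F1:
  assumes "c \<notin> \<int>\<^sub>\<le>\<^sub>0" "z \<in> ball 0 1"
  shows "ereal (norm z) < fps_conv_radius (fps_2F1 a b c)"
  using fps_conv_radius_2F1[OF assms(1), of a b] assms(2)
  by (metis dist_0_norm less_ereal.simps(1) mem_ball one_ereal_def order_less_le_trans)

lemma sums_hyp2F1_series:
  assumes "c \<notin> \<int>\<^sub>\<le>\<^sub>0" "z \<in> ball 0 1"
  shows "(\<lambda>n. fps_nth (fps_2F1 a b c) n * z ^ n) sums hyp2F1_series a b c z"
  unfolding hyp2F1_series_eq_eval_fps
  by (rule sums_eval_fps[OF norm_less_fps_conv_radius_2F1[OF assms]])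

lemma eval_fps_2F1_mult:
  assumes "c \<notin> \<int>\<^sub>\<le>\<^sub>0" "z \<in> ball 0 1"
  shows "eval_fps (fps_const k * fps_X * fps_2F1 a b c) z = k * z * hyp2F1_series a b c z"
    and "ereal (norm z) < fps_conv_radius (fps_const k * fps_X * fps_2F1 a b c)"
    and "eval_fps (fps_const k * fps_2F1 a b c) z = k * hyp2F1_series a b c z"
    and "ereal (norm z) < fps_conv_radius (fps_const k * fps_2F1 a b c)"
proof -
  note r = norm_less_fps_conv_radius_2F1[OF assms, of a b]
  have kX: "fps_conv_radius (fps_const k * fps_X) = \<infinity>"
    using fps_conv_radius_mult[of "fps_const k" "fps_X :: complex fps"] by simp
  show "eval_fps (fps_const k * fps_X * fps_2F1 a b c) z = k * z * hyp2F1_series a b c z"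
    using r kX by (simp add: eval_fps_mult hyp2F1_series_eq_eval_fps)
  show "ereal (norm z) < fps_conv_radius (fps_const k * fps_X * fps_2F1 a b c)"
    using r kX fps_conv_radius_mult[of "fps_const k * fps_X" "fps_2F1 a b c"] by (auto elim: less_le_trans)
  show "eval_fps (fps_const k * fps_2F1 a b c) z = k * hyp2F1_series a b c z"
    using r by (simp add: eval_fps_mult hyp2F1_series_eq_eval_fps)
  show "ereal (norm z) < fps_conv_radius (fps_const k * fps_2F1 a b c)"
    using r fps_conv_radius_mult[of "fps_const k" "fps_2F1 a b c"] by (auto elim: less_le_trans)
qed

text \<open>This is F(c) = F(c + 1) + (z / c) F'(c + 1). It comes from c / (c)_n = (c + n) / (c +
  1)_n, where the n cancels against n! and shifts the sum. In both functions on the right the lower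
  parameter minus the second upper one has grown by 1, which drives the descents below.\<close>

lemma hyp2F1_series_contiguous_lower:
  assumes c: "c \<notin> \<int>\<^sub>\<le>\<^sub>0" and z: "z \<in> ball 0 1"
  shows "c * hyp2F1_series a b c z =
    c * hyp2F1_series a b (c + 1) z + a * b / (c + 1) * z * hyp2F1_series (a + 1) (b + 1) (c + 2) z"
proof -
  have c1: "c + 1 \<notin> \<int>\<^sub>\<le>\<^sub>0" and c2: "c + 2 \<notin> \<int>\<^sub>\<le>\<^sub>0"
    using not_nonpos_Int_plus_of_nat[OF c, of 1] not_nonpos_Int_plus_of_nat[OF c, of 2] by auto
  have "fps_const c * fps_2F1 a b c = fps_const c * fps_2F1 a b (c + 1) +
      fps_const (a * b / (c + 1)) * fps_X * fps_2F1 (a + 1) (b + 1) (c + 2)"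
  proof (rule fps_ext)
    fix n
    show "fps_nth (fps_const c * fps_2F1 a b c) n = fps_nth (fps_const c * fps_2F1 a b (c + 1) +
      fps_const (a * b / (c + 1)) * fps_X * fps_2F1 (a + 1) (b + 1) (c + 2)) n"
    proof (cases n)
      case (Suc m)
      \<comment> \<open>Pochhammer symbols and factorials are abstracted to letters; splitting
        \<open>x\<close> as \<open>c + k\<close> is the whole content.\<close>
      have alg: "c * (a * A * (b * B) / (c * Q * (k * F))) =
          c * (a * A * (b * B) / (d * P * (k * F))) + a * b / d * (A * B / (P * F))"
        if "d * P = Q * x" "c + k = x" "c \<noteq> 0" "x \<noteq> 0" "k \<noteq> 0" for A B Q k F d P x
      proof -
        have "a * b / d * (A * B / (P * F)) = a * b * (A * B) / (Q * x * F)"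
          using that(1) by (simp flip: that(1))
        moreover have "c * (a * A * (b * B) / (d * P * (k * F))) + a * b * (A * B) / (Q * x * F) =
            a * b * A * B / (Q * x * k * F) * (c + k)"
          using that(3-) unfolding that(1) by (simp add: ring_distribs add_divide_distrib mult_ac)
        moreover have "c * (a * A * (b * B) / (c * Q * (k * F))) = a * b * A * B / (Q * x * k * F) * x"
          using that(3-) by simp
        ultimately show ?thesis by (simp only: that(2))
      qed
      have "c * (a * pochhammer (a + 1) m * (b * pochhammer (b + 1) m) / (c * pochhammer (c + 1) m * (of_nat (Suc m) * fact m))) =
          c * (a * pochhammer (a + 1) m * (b * pochhammer (b + 1) m) / ((c + 1) * pochhammer (c + 2) m * (of_nat (Suc m) * fact m))) +
          a * b / (c + 1) * (pochhammer (a + 1) m * pochhammer (b + 1) m / (pochhammer (c + 2) m * fact m))"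
      proof (rule alg)
        show "(c + 1) * pochhammer (c + 2) m = pochhammer (c + 1) m * (c + 1 + of_nat m)"
          using pochhammer_rec[of "c + 1" m] pochhammer_Suc[of "c + 1" m] by (simp add: add.assoc)
        show "c \<noteq> 0" "c + 1 + of_nat m \<noteq> 0"
          using plus_of_nat_neq_0[OF c, of 0] plus_of_nat_neq_0[OF c1, of m] by auto
      qed (auto simp del: of_nat_Suc intro!: of_nat_neq_0, simp)
      then show ?thesis
        unfolding Suc
        by (simp add: fps_2F1_def mult.assoc pochhammer_rec add.assoc del: of_nat_Suc)
    qed (simp add: fps_2F1_def)
  qed
  then have "eval_fps (fps_const c * fps_2F1 a b c) z = eval_fps (fps_const c * fps_2F1 a b (c + 1) +
      fps_const (a * b / (c + 1)) * fps_X * fps_2F1 (a + 1) (b + 1) (c + 2)) z"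
    by simp
  then show ?thesis
    unfolding eval_fps_add[OF eval_fps_2F1_mult(4)[OF c1 z] eval_fps_2F1_mult(2)[OF c2 z]]
      eval_fps_2F1_mult(3)[OF c z] eval_fps_2F1_mult(3)[OF c1 z] eval_fps_2F1_mult(1)[OF c2 z] .
qed

text \<open>Write (b)_n = b (b + 1)_(n-1) and split b = (b + n) - n: the first part gives (b + 1)_n,
  the second a sum shifted by one. Both functions on the right have b + 1, so repetition makes the
  real part of b positive.\<close>

lemma hyp2F1_series_contiguous_raise:
  assumes c: "c \<notin> \<int>\<^sub>\<le>\<^sub>0" and z: "z \<in> ball 0 1"
  shows "hyp2F1_series a b c z =
    hyp2F1_series a (b + 1) c z + (- a / c) * z * hyp2F1_series (a + 1) (b + 1) (c + 1) z"
proof -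
  have c1: "c + 1 \<notin> \<int>\<^sub>\<le>\<^sub>0"
    using not_nonpos_Int_plus_of_nat[OF c, of 1] by auto
  have "fps_2F1 a b c = fps_const 1 * fps_2F1 a (b + 1) c +
      fps_const (- a / c) * fps_X * fps_2F1 (a + 1) (b + 1) (c + 1)"
  proof (rule fps_ext)
    fix n
    show "fps_nth (fps_2F1 a b c) n = fps_nth (fps_const 1 * fps_2F1 a (b + 1) c +
      fps_const (- a / c) * fps_X * fps_2F1 (a + 1) (b + 1) (c + 1)) n"
    proof (cases n)
      case (Suc m)
      have alg: "a * A * (b * B) / (c * Q * (k * F)) =
          a * A * (B * (b + k)) / (c * Q * (k * F)) + - a / c * (A * B / (Q * F))"
        if "k \<noteq> 0" for A B Q k F
        using that by (simp add: ring_distribs add_divide_distrib mult_ac)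
      have "pochhammer (b + 1) (Suc m) = pochhammer (b + 1) m * (b + of_nat (Suc m))"
        by (simp add: pochhammer_Suc add_ac)
      then show ?thesis
        unfolding Suc using alg[OF of_nat_neq_0[of m], of "pochhammer (a + 1) m" "pochhammer (b + 1) m" "pochhammer (c + 1) m" "fact m"]
        by (simp add: fps_2F1_def mult.assoc pochhammer_rec[of a] pochhammer_rec[of b] pochhammer_rec[of c] del: of_nat_Suc)
    qed (simp add: fps_2F1_def)
  qed
  then have "eval_fps (fps_2F1 a b c) z = eval_fps (fps_const 1 * fps_2F1 a (b + 1) c +
      fps_const (- a / c) * fps_X * fps_2F1 (a + 1) (b + 1) (c + 1)) z"
    by simp
  then show ?thesis
    unfolding eval_fps_add[OF eval_fps_2F1_mult(4)[OF c z] eval_fps_2F1_mult(2)[OF c1 z]]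
      eval_fps_2F1_mult(3)[OF c z] eval_fps_2F1_mult(1)[OF c1 z] by (simp flip: hyp2F1_series_eq_eval_fps)
qed

section \<open>Analytic continuation\<close>

text \<open>Any continuation, however constructed, computes \<open>hyp2F1\<close>: by the identity
  theorem on the connected slit plane all continuations share their value at z, so the definite
  description is justified.\<close>

lemma hyp2F1_eqI:
  assumes "f holomorphic_on slit_plane" "\<And>u. u \<in> ball 0 1 \<Longrightarrow> f u = hyp2F1_series a b c u"
    and "z \<in> slit_plane"
  shows "hyp2F1 a b c z = f z"
  unfolding hyp2F1_def
proof (rule the_equality)
  show "\<exists>g. g holomorphic_on slit_plane \<and> (\<forall>u\<in>ball 0 1. g u = hyp2F1_series a b c u) \<and> g z = f z"
    using assms by blast
  fix w assume "\<exists>g. g holomorphic_on slit_plane \<and> (\<forall>u\<in>ball 0 1. g u = hyp2F1_series a b c u) \<and> g z = w"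
  then obtain g where g: "g holomorphic_on slit_plane" "\<And>u. u \<in> ball 0 1 \<Longrightarrow> g u = hyp2F1_series a b c u"
    and w: "g z = w" by blast
  have "g z = f z"
    by (rule holomorphic_slit_plane_eqI[OF g(1) assms(1) _ assms(3)]) (simp only: g(2) assms(2))
  then show "w = f z" using w by simp
qed

lemma Re_pos_not_nonpos_Int: "Re z > 0 \<Longrightarrow> z \<notin> \<int>\<^sub>\<le>\<^sub>0"
  by (auto elim!: nonpos_Ints_cases)

text \<open>Origin of the multiplier on Taylor coefficients: each unit step from s to s + 1
  multiplies the Beta value by s / (s + \<mu>).\<close>

lemma Beta_plus_of_nat:
  assumes "Re s > 0" "Re \<mu> > 0"
  shows "Beta (s + of_nat n) \<mu> = Beta s \<mu> * (pochhammer s n / pochhammer (s + \<mu>) n)"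
proof (induction n)
  case (Suc n)
  have nz: "s + \<mu> + of_nat n \<noteq> 0"
    using assms by (auto simp: complex_eq_iff)
  have "(s + of_nat n + \<mu>) * Beta (s + of_nat n + 1) \<mu> = (s + of_nat n) * Beta (s + of_nat n) \<mu>"
    using assms by (intro Beta_plus1_left Re_pos_not_nonpos_Int) auto
  then have "Beta (s + of_nat n + 1) \<mu> = (s + of_nat n) / (s + \<mu> + of_nat n) * Beta (s + of_nat n) \<mu>"
    using nz by (simp add: field_simps)
  then show ?case
    unfolding Suc.IH by (simp add: pochhammer_Suc add_ac mult_ac)
qed simp

lemma set_integrable_Beta_kernel:
  assumes "Re s > 0" "Re \<mu> > 0"
  shows "set_integrable lborel {0<..<1} (\<lambda>t. complex_of_real t powr (s - 1) * of_real (1 - t) powr (\<mu> - 1))"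
  using has_lebesgue_integral_on_Beta[OF assms] by (simp add: has_lebesgue_integral_on_def)

lemma Beta_kernel_power_series:
  assumes s: "Re s > 0" "Re \<mu> > 0"
    and G: "\<And>u. u \<in> ball 0 1 \<Longrightarrow> (\<lambda>n. g n * u ^ n) sums G u" and z: "z \<in> ball 0 1"
  shows "(\<lambda>n. Beta s \<mu> * (pochhammer s n / pochhammer (s + \<mu>) n * g n * z ^ n)) sums
    (LINT t:{0<..<1}|lborel. of_real t powr (s - 1) * of_real (1 - t) powr (\<mu> - 1) * G (of_real t * z))"
proof -
  have "(LINT t:{0<..<1}|lborel. of_real t powr (s - 1) * of_real (1 - t) powr (\<mu> - 1) * of_real t ^ n) =
      Beta s \<mu> * (pochhammer s n / pochhammer (s + \<mu>) n)" for n
  proof -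
    have "has_lebesgue_integral_on (\<lambda>t. of_real t powr (s + of_nat n - 1) * of_real (1 - t) powr (\<mu> - 1))
        (Beta (s + of_nat n) \<mu>) {0<..<1}"
      using s by (intro has_lebesgue_integral_on_Beta) auto
    also have "?this \<longleftrightarrow> has_lebesgue_integral_on
        (\<lambda>t. of_real t powr (s - 1) * of_real (1 - t) powr (\<mu> - 1) * of_real t ^ n)
        (Beta (s + of_nat n) \<mu>) {0<..<1}"
    proof (rule has_lebesgue_integral_on_cong)
      fix t :: real assume "t \<in> {0<..<1}"
      then have "complex_of_real t powr (s + of_nat n - 1) = of_real t powr (s - 1) * of_real t ^ n"
        using powr_add[of "complex_of_real t" "s - 1" "of_nat n"] by (simp add: powr_nat' algebra_simps)
      then show "of_real t powr (s + of_nat n - 1) * of_real (1 - t) powr (\<mu> - 1) =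
          of_real t powr (s - 1) * of_real (1 - t) powr (\<mu> - 1) * of_real t ^ n" by (simp only: mult_ac)
    qed
    finally show ?thesis
      by (simp add: has_lebesgue_integral_on_def Beta_plus_of_nat s)
  qed
  then show ?thesis
    using set_integral_scaled_power_series[OF set_integrable_Beta_kernel[OF s] G z] by (simp add: mult.assoc)
qed

lemma one_minus_powr_sums:
  fixes a :: complex
  assumes "z \<in> ball 0 1"
  shows "(\<lambda>n. pochhammer a n / fact n * z ^ n) sums (1 - z) powr (- a)"
proof -
  have "(- a gchoose n) * (- z) ^ n = pochhammer a n / fact n * z ^ n" for n
    by (simp add: gbinomial_pochhammer power_minus[of z] mult_ac)
  then show ?thesis
    using gen_binomial_complex[of "- z" "- a"] assms by simp
qed

lemma holomorphic_one_minus_powr: "(\<lambda>z. (1 - z) powr k) holomorphic_on slit_plane"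
  by (intro holomorphic_intros) (auto simp: slit_plane_iff complex_nonpos_Reals_iff)

text \<open>The binomial series contributes (a)_n / n!, and the Beta kernel with s = b and \<mu> = c
  - b multiplies it by (b)_n / (c)_n. The comparison is with the series itself because this integral
  is a source of the continuation.\<close>

lemma Euler_integral_continuation:
  fixes a b c :: complex
  assumes b: "Re b > 0" "Re c > Re b"
  defines "f \<equiv> \<lambda>z. (LINT t:{0<..<1}|lborel. of_real t powr (b - 1) * of_real (1 - t) powr (c - b - 1) *
                    (1 - of_real t * z) powr (- a)) / Beta b (c - b)"
  shows "f holomorphic_on slit_plane" and "\<And>u. u \<in> ball 0 1 \<Longrightarrow> f u = hyp2F1_series a b c u"
proof -
  have Re: "Re (c - b) > 0" using b by simp
  have B: "Beta b (c - b) \<noteq> 0"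
    using b Re Re_pos_not_nonpos_Int[of b] Re_pos_not_nonpos_Int[of "c - b"] Re_pos_not_nonpos_Int[of c]
    by (simp add: Beta_def Gamma_eq_zero_iff)
  show "f holomorphic_on slit_plane"
    unfolding f_def
    by (intro holomorphic_intros holomorphic_on_set_integral_scaled set_integrable_Beta_kernel
        holomorphic_one_minus_powr b Re B)
  fix u :: complex assume u: "u \<in> ball 0 1"
  have "(\<lambda>n. Beta b (c - b) * (pochhammer b n / pochhammer (b + (c - b)) n * (pochhammer a n / fact n) * u ^ n))
      sums (LINT t:{0<..<1}|lborel. of_real t powr (b - 1) * of_real (1 - t) powr (c - b - 1) *
                    (1 - of_real t * u) powr (- a))"
    by (intro Beta_kernel_power_series[OF b(1) Re _ u] one_minus_powr_sums)
  from sums_divide[OF this, of "Beta b (c - b)"] B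
  have "(\<lambda>n. pochhammer a n * pochhammer b n / (pochhammer c n * fact n) * u ^ n) sums f u"
    by (simp add: f_def mult_ac)
  then show "f u = hyp2F1_series a b c u"
    by (simp add: hyp2F1_series_def sums_iff)
qed

text \<open>The Euler integral gives the continuation for \<open>Re c > Re b > 0\<close>; the contiguous relations
  remove first the condition on \<open>c\<close>, then the one on \<open>b\<close>.\<close>
lemma hyp2F1_continuation_exists:
  assumes "c \<notin> \<int>\<^sub>\<le>\<^sub>0"
  shows "\<exists>f. f holomorphic_on slit_plane \<and> (\<forall>u\<in>ball 0 1. f u = hyp2F1_series a b c u)"
proof -
  \<comment> \<open>\<open>n\<close> bounds how far Re c may lie below Re b. The lowering relation
    raises c - b by one in both terms; all parameters are general since its second term shifts each
    of them.\<close>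
  have step1: "\<exists>f. f holomorphic_on slit_plane \<and> (\<forall>u\<in>ball 0 1. f u = hyp2F1_series a b c u)"
    if "Re b > 0" "c \<notin> \<int>\<^sub>\<le>\<^sub>0" "Re c + real n > Re b" for a b c n
    using that
  proof (induction n arbitrary: a b c)
    case 0
    then have "Re c > Re b" by simp
    from Euler_integral_continuation[OF 0(1) this] show ?case by blast
  next
    case (Suc n)
    have c1: "c + 1 \<notin> \<int>\<^sub>\<le>\<^sub>0" and c2: "c + 2 \<notin> \<int>\<^sub>\<le>\<^sub>0" and "c \<noteq> 0"
      using not_nonpos_Int_plus_of_nat[OF Suc.prems(2), of 1] not_nonpos_Int_plus_of_nat[OF Suc.prems(2), of 2]
        plus_of_nat_neq_0[OF Suc.prems(2), of 0] by auto
    obtain f where f: "f holomorphic_on slit_plane" "\<forall>u\<in>ball 0 1. f u = hyp2F1_series a b (c + 1) u"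
      using Suc.IH[of b "c + 1" a] Suc.prems c1 by auto
    obtain g where g: "g holomorphic_on slit_plane" "\<forall>u\<in>ball 0 1. g u = hyp2F1_series (a + 1) (b + 1) (c + 2) u"
      using Suc.IH[of "b + 1" "c + 2" "a + 1"] Suc.prems c2 by auto
    have "(\<lambda>z. (c * f z + a * b / (c + 1) * z * g z) / c) holomorphic_on slit_plane"
      using f g \<open>c \<noteq> 0\<close> by (intro holomorphic_intros) auto
    moreover have "(c * f u + a * b / (c + 1) * u * g u) / c = hyp2F1_series a b c u" if "u \<in> ball 0 1" for u
      using hyp2F1_series_contiguous_lower[OF Suc.prems(2) that, of a b] f g that \<open>c \<noteq> 0\<close>
      by (simp add: divide_eq_eq mult.commute[of _ c])
    ultimately show ?case by blast
  qed
  \<comment> \<open>Here \<open>n\<close> bounds how far Re b may lie below 0; the raising relation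
    has b + 1 in both terms.\<close>
  have step2: "\<exists>f. f holomorphic_on slit_plane \<and> (\<forall>u\<in>ball 0 1. f u = hyp2F1_series a b c u)"
    if "Re b + real n > 0" "c \<notin> \<int>\<^sub>\<le>\<^sub>0" for a b c n
    using that
  proof (induction n arbitrary: a b c)
    case 0
    obtain n where "real n > Re b - Re c" using reals_Archimedean2 by blast
    then show ?case using step1[of b c n a] 0 by auto
  next
    case (Suc n)
    have c1: "c + 1 \<notin> \<int>\<^sub>\<le>\<^sub>0"
      using not_nonpos_Int_plus_of_nat[OF Suc.prems(2), of 1] by auto
    obtain f where f: "f holomorphic_on slit_plane" "\<forall>u\<in>ball 0 1. f u = hyp2F1_series a (b + 1) c u"
      using Suc.IH[of "b + 1" c a] Suc.prems by auto
    obtain g where g: "g holomorphic_on slit_plane" "\<forall>u\<in>ball 0 1. g u = hyp2F1_series (a + 1) (b + 1) (c + 1) u"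
      using Suc.IH[of "b + 1" "c + 1" "a + 1"] Suc.prems c1 by auto
    have "(\<lambda>z. f z + (- a / c) * z * g z) holomorphic_on slit_plane"
      using f g by (intro holomorphic_intros)
    moreover have "f u + (- a / c) * u * g u = hyp2F1_series a b c u" if "u \<in> ball 0 1" for u
      using hyp2F1_series_contiguous_raise[OF Suc.prems(2) that, of a b] f g that by simp
    ultimately show ?case by blast
  qed
  obtain n where "real n > - Re b" using reals_Archimedean2 by blast
  then show ?thesis using step2[of b n c a] assms by auto
qed

lemma holomorphic_hyp2F1: "c \<notin> \<int>\<^sub>\<le>\<^sub>0 \<Longrightarrow> hyp2F1 a b c holomorphic_on slit_plane"
  and hyp2F1_eq_series: "c \<notin> \<int>\<^sub>\<le>\<^sub>0 \<Longrightarrow> u \<in> ball 0 1 \<Longrightarrow> hyp2F1 a b c u = hyp2F1_series a b c u"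
proof -
  assume c: "c \<notin> \<int>\<^sub>\<le>\<^sub>0"
  obtain f where f: "f holomorphic_on slit_plane" "\<And>u. u \<in> ball 0 1 \<Longrightarrow> f u = hyp2F1_series a b c u"
    using hyp2F1_continuation_exists[OF c] by blast
  have eq: "hyp2F1 a b c z = f z" if "z \<in> slit_plane" for z
    by (rule hyp2F1_eqI[OF f that])
  show "hyp2F1 a b c holomorphic_on slit_plane"
    using f(1) by (rule holomorphic_transform) (simp add: eq)
  show "hyp2F1 a b c u = hyp2F1_series a b c u" if "u \<in> ball 0 1"
    using eq f(2) that ball_subset_slit_plane by auto
qed

lemma hyp2F1_commute: "hyp2F1 a b c z = hyp2F1 b a c z"
  by (simp add: hyp2F1_def hyp2F1_series_def mult.commute[of "pochhammer a _"])

lemma hyp2F1_contiguous_lower: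
  assumes c: "c \<notin> \<int>\<^sub>\<le>\<^sub>0" and z: "z \<in> slit_plane"
  shows "c * hyp2F1 a b c z =
    c * hyp2F1 a b (c + 1) z + a * b / (c + 1) * z * hyp2F1 (a + 1) (b + 1) (c + 2) z"
proof -
  have c1: "c + 1 \<notin> \<int>\<^sub>\<le>\<^sub>0" and c2: "c + 2 \<notin> \<int>\<^sub>\<le>\<^sub>0"
    using not_nonpos_Int_plus_of_nat[OF c, of 1] not_nonpos_Int_plus_of_nat[OF c, of 2] by auto
  show ?thesis
  proof (rule holomorphic_slit_plane_eqI[OF _ _ _ z])
    fix u :: complex assume u: "u \<in> ball 0 1"
    show "c * hyp2F1 a b c u =
      c * hyp2F1 a b (c + 1) u + a * b / (c + 1) * u * hyp2F1 (a + 1) (b + 1) (c + 2) u"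
      using hyp2F1_series_contiguous_lower[OF c u, of a b]
      by (simp only: hyp2F1_eq_series[OF c u] hyp2F1_eq_series[OF c1 u] hyp2F1_eq_series[OF c2 u])
  qed (intro holomorphic_intros holomorphic_hyp2F1 c c1 c2)+
qed

section \<open>Euler and Bateman integrals\<close>

lemma Euler_integral:
  assumes b: "Re b > 0" "Re c > Re b" and z: "z \<in> slit_plane"
  shows "has_lebesgue_integral_on (\<lambda>t. of_real t powr (b - 1) * of_real (1 - t) powr (c - b - 1) *
           (1 - of_real t * z) powr (- a)) (Beta b (c - b) * hyp2F1 a b c z) {0<..<1}"
proof -
  have Re: "Re (c - b) > 0" using b by simp
  have "Beta b (c - b) \<noteq> 0"
    using b Re Re_pos_not_nonpos_Int[of b] Re_pos_not_nonpos_Int[of "c - b"] Re_pos_not_nonpos_Int[of c]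
    by (simp add: Beta_def Gamma_eq_zero_iff)
  moreover have "hyp2F1 a b c z = (LINT t:{0<..<1}|lborel. of_real t powr (b - 1) * of_real (1 - t) powr (c - b - 1) *
      (1 - of_real t * z) powr (- a)) / Beta b (c - b)"
    by (rule hyp2F1_eqI[OF Euler_integral_continuation[OF b] z])
  ultimately show ?thesis
    unfolding has_lebesgue_integral_on_def
    using set_integrable_mult_holomorphic[OF set_integrable_Beta_kernel[OF b(1) Re] holomorphic_one_minus_powr z]
    by simp
qed

text \<open>\<open>coeffs\<close> isolates the one fact that varies: that the multiplier (s)_n / (s
  + \<mu>)_n turns one Gauss series into another. Both sides are holomorphic in z, so agreement on
  the disc suffices.\<close>

lemma Beta_kernel_hyp2F1:
  assumes s: "Re s > 0" "Re \<mu> > 0" and c: "c \<notin> \<int>\<^sub>\<le>\<^sub>0" "c' \<notin> \<int>\<^sub>\<le>\<^sub>0" and z: "z \<in> slit_plane"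
    and coeffs: "\<And>n. pochhammer s n / pochhammer (s + \<mu>) n * fps_nth (fps_2F1 a b c) n = fps_nth (fps_2F1 a' b' c') n"
  shows "has_lebesgue_integral_on (\<lambda>t. of_real t powr (s - 1) * of_real (1 - t) powr (\<mu> - 1) *
           hyp2F1 a b c (of_real t * z)) (Beta s \<mu> * hyp2F1 a' b' c' z) {0<..<1}"
proof -
  note k = set_integrable_Beta_kernel[OF s] and hol = holomorphic_hyp2F1[OF c(1), of a b]
  have "(LINT t:{0<..<1}|lborel. of_real t powr (s - 1) * of_real (1 - t) powr (\<mu> - 1) *
           hyp2F1 a b c (of_real t * z)) = Beta s \<mu> * hyp2F1 a' b' c' z"
  proof (rule holomorphic_slit_plane_eqI[OF holomorphic_on_set_integral_scaled[OF k hol] _ _ z])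
    show "(\<lambda>z. Beta s \<mu> * hyp2F1 a' b' c' z) holomorphic_on slit_plane"
      by (intro holomorphic_intros holomorphic_hyp2F1 c)
    fix u :: complex assume u: "u \<in> ball 0 1"
    have "(\<lambda>n. fps_nth (fps_2F1 a b c) n * v ^ n) sums hyp2F1 a b c v" if "v \<in> ball 0 1" for v
      using sums_hyp2F1_series[OF c(1) that] by (simp only: hyp2F1_eq_series[OF c(1) that])
    from Beta_kernel_power_series[OF s this u]
    have "(\<lambda>n. Beta s \<mu> * (fps_nth (fps_2F1 a' b' c') n * u ^ n)) sums
        (LINT t:{0<..<1}|lborel. of_real t powr (s - 1) * of_real (1 - t) powr (\<mu> - 1) * hyp2F1 a b c (of_real t * u))"
      unfolding coeffs .
    moreover have "(\<lambda>n. Beta s \<mu> * (fps_nth (fps_2F1 a' b' c') n * u ^ n)) sums (Beta s \<mu> * hyp2F1 a' b' c' u)"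
      using sums_mult[OF sums_hyp2F1_series[OF c(2) u]] by (simp only: hyp2F1_eq_series[OF c(2) u])
    ultimately show "(LINT t:{0<..<1}|lborel. of_real t powr (s - 1) * of_real (1 - t) powr (\<mu> - 1) *
        hyp2F1 a b c (of_real t * u)) = Beta s \<mu> * hyp2F1 a' b' c' u"
      by (rule sums_unique2)
  qed
  then show ?thesis
    using set_integrable_mult_holomorphic[OF k hol z] by (simp add: has_lebesgue_integral_on_def)
qed

text \<open>For s = c the numerator of the multiplier cancels (c)_n, and (c + \<mu>)_n takes its
  place.\<close>

lemma Bateman_integral_lower:
  assumes c: "Re c > 0" and \<mu>: "Re \<mu> > 0" and z: "z \<in> slit_plane"
  shows "has_lebesgue_integral_on (\<lambda>t. of_real t powr (c - 1) * of_real (1 - t) powr (\<mu> - 1) *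
           hyp2F1 a b c (of_real t * z)) (Beta c \<mu> * hyp2F1 a b (c + \<mu>) z) {0<..<1}"
proof (rule Beta_kernel_hyp2F1[OF c \<mu> _ _ z])
  show c': "c \<notin> \<int>\<^sub>\<le>\<^sub>0" using c by (rule Re_pos_not_nonpos_Int)
  show "c + \<mu> \<notin> \<int>\<^sub>\<le>\<^sub>0" using c \<mu> by (intro Re_pos_not_nonpos_Int) simp
  show "pochhammer c n / pochhammer (c + \<mu>) n * fps_nth (fps_2F1 a b c) n = fps_nth (fps_2F1 a b (c + \<mu>)) n" for n
    using pochhammer_not_nonpos_Int[OF c', of n] by (simp add: fps_2F1_def)
qed

text \<open>With s + \<mu> as an upper parameter, the denominator of the multiplier cancels it and
  (s)_n takes its place.\<close>

lemma Bateman_integral_upper: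
  assumes s: "Re s > 0" and \<mu>: "Re \<mu> > 0" and c: "c \<notin> \<int>\<^sub>\<le>\<^sub>0" and z: "z \<in> slit_plane"
  shows "has_lebesgue_integral_on (\<lambda>t. of_real t powr (s - 1) * of_real (1 - t) powr (\<mu> - 1) *
           hyp2F1 (s + \<mu>) b c (of_real t * z)) (Beta s \<mu> * hyp2F1 s b c z) {0<..<1}"
proof (rule Beta_kernel_hyp2F1[OF s \<mu> c c z])
  have "s + \<mu> \<notin> \<int>\<^sub>\<le>\<^sub>0" using s \<mu> by (intro Re_pos_not_nonpos_Int) simp
  then show "pochhammer s n / pochhammer (s + \<mu>) n * fps_nth (fps_2F1 (s + \<mu>) b c) n = fps_nth (fps_2F1 s b c) n" for n
    using pochhammer_not_nonpos_Int[of "s + \<mu>" n] by (simp add: fps_2F1_def)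
qed

section \<open>Euler's transformation\<close>

text \<open>The hypergeometric differential operator. On formal series its n-th coefficient involves
  only two consecutive coefficients of \<open>f\<close>, so its kernel is described by a first-order
  recursion.\<close>

definition fps_2F1_ode :: "complex \<Rightarrow> complex \<Rightarrow> complex \<Rightarrow> complex fps \<Rightarrow> complex fps" where
  "fps_2F1_ode a b c f = fps_X * (1 - fps_X) * fps_deriv (fps_deriv f) +
     (fps_const c - (fps_const a + fps_const b + 1) * fps_X) * fps_deriv f - fps_const a * fps_const b * f"

lemma fps_2F1_ode_nth:
  "fps_nth (fps_2F1_ode a b c f) n =
     of_nat (Suc n) * (c + of_nat n) * fps_nth f (Suc n) - (a + of_nat n) * (b + of_nat n) * fps_nth f n"
proof -
  have eq: "fps_2F1_ode a b c f = fps_X * fps_deriv (fps_deriv f) - fps_X * (fps_X * fps_deriv (fps_deriv f)) +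
     fps_const c * fps_deriv f - fps_const (a + b + 1) * (fps_X * fps_deriv f) - fps_const (a * b) * f"
    unfolding fps_2F1_ode_def by (simp add: algebra_simps flip: fps_const_add fps_const_mult)
  show ?thesis
    unfolding eq by (cases n; cases "n - 1") (auto simp: algebra_simps)
qed

text \<open>For such c the factor (n + 1) (c + n) in front of the next coefficient never vanishes,
  so the recursion determines \<open>f\<close> from its constant term.\<close>

lemma fps_2F1_ode_unique:
  assumes "c \<notin> \<int>\<^sub>\<le>\<^sub>0" "fps_2F1_ode a b c f = 0" "fps_nth f 0 = 1"
  shows "f = fps_2F1 a b c"
proof (rule fps_ext)
  show "fps_nth f n = fps_nth (fps_2F1 a b c) n" for n
  proof (induction n)
    case (Suc n)
    have "of_nat (Suc n) * (c + of_nat n) * fps_nth f (Suc n) = (a + of_nat n) * (b + of_nat n) * fps_nth f n"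
      using fps_2F1_ode_nth[of a b c f n] assms(2) by simp
    also have "\<dots> = of_nat (Suc n) * (c + of_nat n) * fps_nth (fps_2F1 a b c) (Suc n)"
      using fps_2F1_nth_Suc[OF assms(1), of n a b] Suc.IH by simp
    finally show ?case
      using plus_of_nat_neq_0[OF assms(1), of n] by (simp del: of_nat_Suc)
  qed (simp add: assms fps_2F1_def)
qed

text \<open>\<open>P\<close> stands for (1 - x)^K with derivatives \<open>P1\<close>,
  \<open>P2\<close>, and \<open>f1\<close>, \<open>f2\<close> are the derivatives of
  \<open>f\<close>; the products are expanded by Leibniz. The derivatives of \<open>P\<close> are
  known only after multiplication by 1 - x, and a ring admits no division, hence the factor (1 -
  x)^2.\<close>

lemma hypergeometric_ode_power_transform:
  fixes x :: "'a :: comm_ring_1"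
  assumes P1: "(1 - x) * P1 = - K * P" and P2: "(1 - x) * P2 = P1 - K * P1" and K: "K = A + B - C"
    and f: "x * (1 - x) * f2 + (C - (A + B + 1) * x) * f1 - A * B * f = 0"
  shows "(1 - x)^2 * (x * (1 - x) * (P2 * f + 2 * P1 * f1 + P * f2) +
    (C - ((C - A) + (C - B) + 1) * x) * (P1 * f + P * f1) - (C - A) * (C - B) * (P * f)) = 0"
proof -
  have "(1 - x)^2 * P2 = (1 - K) * ((1 - x) * P1)"
    unfolding power2_eq_square mult.assoc P2 by (simp add: algebra_simps)
  then have P2': "(1 - x)^2 * P2 = (1 - K) * (- K * P)" unfolding P1 .
  have "(1 - x)^2 * (x * (1 - x) * (P2 * f + 2 * P1 * f1 + P * f2) +
    (C - ((C - A) + (C - B) + 1) * x) * (P1 * f + P * f1) - (C - A) * (C - B) * (P * f)) =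
    x * (1 - x) * (((1 - x)^2 * P2) * f + 2 * (1 - x) * ((1 - x) * P1) * f1 + (1 - x)^2 * P * f2) +
    (C - ((C - A) + (C - B) + 1) * x) * ((1 - x) * ((1 - x) * P1) * f + (1 - x)^2 * P * f1) -
    (C - A) * (C - B) * ((1 - x)^2 * P * f)"
    by (simp add: algebra_simps power2_eq_square)
  also have "\<dots> = (1 - x)^2 * P * (x * (1 - x) * f2 + (C - (A + B + 1) * x) * f1 - A * B * f)"
    unfolding P2' P1 K by (simp add: algebra_simps power2_eq_square)
  finally show ?thesis unfolding f by simp
qed

text \<open>\<open>fps_2F1 (a + b - c) 1 1\<close> is the binomial series of (1 - X)^(c - a - b), as
  the two parameters 1 cancel. The product solves the equation for a, b, c with constant term 1, so
  uniqueness identifies it and no convolution of coefficients has to be summed.\<close>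

lemma fps_2F1_Euler_transformation:
  assumes c: "c \<notin> \<int>\<^sub>\<le>\<^sub>0"
  shows "fps_2F1 (a + b - c) 1 1 * fps_2F1 (c - a) (c - b) c = fps_2F1 a b c"
proof -
  define P where "P = fps_2F1 (a + b - c) 1 1"
  define f where "f = fps_2F1 (c - a) (c - b) c"
  define k where "k = (c - a) + (c - b) - c"
  have P1: "(1 - fps_X) * fps_deriv P = - fps_const k * P"
  proof (rule fps_ext)
    fix n
    have "of_nat (Suc n) * (1 + of_nat n) * fps_nth P (Suc n) = (a + b - c + of_nat n) * (1 + of_nat n) * fps_nth P n"
      unfolding P_def by (rule fps_2F1_nth_Suc) simp
    then have "(1 + of_nat n) * (of_nat (Suc n) * fps_nth P (Suc n)) = (1 + of_nat n) * ((of_nat n - k) * fps_nth P n)"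
      by (simp add: k_def algebra_simps)
    then have "of_nat (Suc n) * fps_nth P (Suc n) = (of_nat n - k) * fps_nth P n"
      by (simp only: mult_cancel_left) (metis of_nat_Suc of_nat_neq_0)
    then show "fps_nth ((1 - fps_X) * fps_deriv P) n = fps_nth (- fps_const k * P) n"
      by (cases n) (auto simp: algebra_simps)
  qed
  have P2: "(1 - fps_X) * fps_deriv (fps_deriv P) = fps_deriv P - fps_const k * fps_deriv P"
    using arg_cong[OF P1, of fps_deriv] by (simp add: algebra_simps del: fps_const_neg)
  have "fps_2F1_ode (c - a) (c - b) c f = 0"
    by (rule fps_ext) (use fps_2F1_nth_Suc[OF c, of _ "c - a" "c - b"] in \<open>simp add: fps_2F1_ode_nth f_def\<close>)
  then have "(1 - fps_X)^2 * fps_2F1_ode (c - (c - a)) (c - (c - b)) c (P * f) = 0"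
    using hypergeometric_ode_power_transform[OF P1 P2, of "fps_const (c - a)" "fps_const (c - b)" "fps_const c"
        "fps_deriv (fps_deriv f)" "fps_deriv f" f]
    unfolding fps_2F1_ode_def k_def
    by (simp add: algebra_simps)
  \<comment> \<open>Formal power series over a field form an integral domain, so this factor can be
    cancelled.\<close>
  moreover have "(1 - fps_X)^2 \<noteq> (0 :: complex fps)"
  proof -
    have "fps_nth (1 - fps_X :: complex fps) 0 = 1" by simp
    then show ?thesis by (metis fps_zero_nth power_eq_0_iff zero_neq_one)
  qed
  ultimately have "fps_2F1_ode a b c (P * f) = 0" by simp
  from fps_2F1_ode_unique[OF c this] show ?thesis
    by (simp add: P_def f_def) (simp add: fps_2F1_def)
qed

lemma hyp2F1_Euler_transformation:
  assumes c: "c \<notin> \<int>\<^sub>\<le>\<^sub>0" and z: "z \<in> slit_plane"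
  shows "hyp2F1 a b c z = (1 - z) powr (c - a - b) * hyp2F1 (c - a) (c - b) c z"
proof (rule holomorphic_slit_plane_eqI[OF _ _ _ z])
  show "(\<lambda>z. (1 - z) powr (c - a - b) * hyp2F1 (c - a) (c - b) c z) holomorphic_on slit_plane"
    by (intro holomorphic_on_mult holomorphic_one_minus_powr holomorphic_hyp2F1 c)
  fix u :: complex assume u: "u \<in> ball 0 1"
  have one: "(1 :: complex) \<notin> \<int>\<^sub>\<le>\<^sub>0" by simp
  have "hyp2F1_series (a + b - c) 1 1 u = (1 - u) powr (- (a + b - c))"
    using one_minus_powr_sums[OF u, of "a + b - c"]
    by (simp add: hyp2F1_series_def sums_iff pochhammer_fact[symmetric])
  moreover have "hyp2F1_series a b c u = hyp2F1_series (a + b - c) 1 1 u * hyp2F1_series (c - a) (c - b) c u"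
    unfolding hyp2F1_series_eq_eval_fps fps_2F1_Euler_transformation[OF c, symmetric, of a b]
    by (intro eval_fps_mult norm_less_fps_conv_radius_2F1 c one u)
  moreover have "- (a + b - c) = c - a - b" by simp
  ultimately show "hyp2F1 a b c u = (1 - u) powr (c - a - b) * hyp2F1 (c - a) (c - b) c u"
    by (simp only: hyp2F1_eq_series[OF c u])
qed (rule holomorphic_hyp2F1[OF c])

section \<open>Weyl integrals\<close>

lemma continuous_on_of_real_powr:
  assumes "continuous_on S g" "\<And>x. x \<in> S \<Longrightarrow> g x > 0"
  shows "continuous_on S (\<lambda>x. complex_of_real (g x) powr z)"
  by (intro continuous_on_powr_complex continuous_intros assms) (use assms(2) in \<open>force+\<close>)

text \<open>Substituting v = (p / t) u turns p + t v into p (1 + u) and pulls out the powers of p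
  and t. The use below is with p = 1 - t x.\<close>

lemma has_lebesgue_integral_on_Beta_half_line_scaled:
  assumes \<mu>: "Re \<mu> > 0" "Re \<alpha> > Re \<mu>" and p: "p > 0" and t: "t > 0"
  shows "has_lebesgue_integral_on (\<lambda>v. of_real (p + t * v) powr (- \<alpha>) * of_real v powr (\<mu> - 1))
           (of_real p powr (\<mu> - \<alpha>) * of_real t powr (- \<mu>) * Beta \<mu> (\<alpha> - \<mu>)) {0<..}"
proof -
  define g where "g u = p / t * u" for u
  have eq: "g ` {0<..} = {0<..}"
  proof -
    have "x \<in> g ` {0<..}" if "x > 0" for x
      by (rule image_eqI[of _ _ "t / p * x"]) (use p t that in \<open>auto simp: g_def\<close>)
    then show ?thesis using p t by (auto simp: g_def)
  qed
  have "has_lebesgue_integral_on (\<lambda>v. of_real (p + t * v) powr (- \<alpha>) * of_real v powr (\<mu> - 1))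
           (of_real p powr (\<mu> - \<alpha>) * of_real t powr (- \<mu>) * Beta \<mu> (\<alpha> - \<mu>)) (g ` {0<..})"
  proof (rule has_lebesgue_integral_on_change_of_variables[where g' = "\<lambda>_. p / t"])
    have pos: "p + t * v > 0" if "v > 0" for v using p t that by (simp add: add_pos_pos)
    show "continuous_on (g ` {0<..}) (\<lambda>v. complex_of_real (p + t * v) powr (- \<alpha>) * of_real v powr (\<mu> - 1))"
      unfolding eq by (intro continuous_on_mult continuous_on_of_real_powr continuous_intros) (auto intro: pos)
    show "has_lebesgue_integral_on (\<lambda>u. of_real \<bar>p / t\<bar> *
        (of_real (p + t * g u) powr (- \<alpha>) * of_real (g u) powr (\<mu> - 1)))
        (of_real p powr (\<mu> - \<alpha>) * of_real t powr (- \<mu>) * Beta \<mu> (\<alpha> - \<mu>)) {0<..}"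
    proof (subst has_lebesgue_integral_on_cong)
      show "has_lebesgue_integral_on (\<lambda>u. of_real p powr (\<mu> - \<alpha>) * of_real t powr (- \<mu>) *
          (of_real (1 + u) powr (- \<alpha>) * of_real u powr (\<mu> - 1)))
        (of_real p powr (\<mu> - \<alpha>) * of_real t powr (- \<mu>) * Beta \<mu> (\<alpha> - \<mu>)) {0<..}"
        by (intro has_lebesgue_integral_on_mult has_lebesgue_integral_on_Beta_half_line \<mu>)
      fix u :: real assume u: "u \<in> {0<..}"
      have "p + t * g u = p * (1 + u)" using t by (simp add: g_def algebra_simps)
      then have "complex_of_real (p + t * g u) powr (- \<alpha>) = exp (- \<alpha> * (of_real (ln p) + of_real (ln (1 + u))))"
        using p u by (simp only: of_real_powr_eq_exp mult_pos_pos) (simp add: ln_mult of_real_powr_eq_exp del: of_real_mult)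
      moreover have "complex_of_real (g u) powr (\<mu> - 1) =
          exp ((\<mu> - 1) * (of_real (ln p) - of_real (ln t) + of_real (ln u)))"
        using p t u by (simp add: g_def of_real_powr_eq_exp ln_mult ln_div algebra_simps del: of_real_mult of_real_divide)
      moreover have "complex_of_real \<bar>p / t\<bar> = exp (of_real (ln p) - of_real (ln t))"
        using p t by (simp add: exp_diff exp_of_real)
      ultimately show "of_real \<bar>p / t\<bar> *
        (of_real (p + t * g u) powr (- \<alpha>) * of_real (g u) powr (\<mu> - 1)) =
        of_real p powr (\<mu> - \<alpha>) * of_real t powr (- \<mu>) *
          (of_real (1 + u) powr (- \<alpha>) * of_real u powr (\<mu> - 1))"
        using p t u by (simp only: mult_exp_exp)
          (simp add: of_real_powr_eq_exp mult_exp_exp algebra_simps del: of_real_add)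
    qed
    show "(g has_real_derivative p / t) (at u within {0<..})" for u
      unfolding g_def using t by (auto intro!: derivative_eq_intros)
    show "inj_on g {0<..}" using p t by (auto simp: inj_on_def g_def)
    show "g ` {0<..} \<in> sets borel" unfolding eq by simp
  qed auto
  then show ?thesis unfolding eq .
qed

text \<open>In the Euler integral 1 - t (x - v) = (1 - t x) + t v, so the v-integral is a scaled
  Beta integral contributing t^(-\<mu>) (1 - t x)^(\<mu> - \<alpha>). What remains is an Euler
  integral with all three parameters lowered by \<mu> and \<gamma> - \<beta> unchanged. The constant
  is B(\<mu>, \<alpha> - \<mu>) B(\<beta> - \<mu>, \<gamma> - \<beta>) / B(\<beta>, \<gamma> -
  \<beta>).\<close>

lemma Weyl_integral_hyp2F1_aux:
  assumes \<mu>: "Re \<mu> > 0" and \<alpha>: "Re \<alpha> > Re \<mu>" and \<beta>: "Re \<beta> > Re \<mu>" and \<gamma>: "Re \<gamma> > Re \<beta>"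
    and x: "x < 1"
  shows "has_lebesgue_integral_on (\<lambda>v. hyp2F1 \<alpha> \<beta> \<gamma> (of_real (x - v)) * of_real v powr (\<mu> - 1))
    (Gamma \<mu> * Gamma (\<alpha> - \<mu>) * Gamma (\<beta> - \<mu>) * Gamma \<gamma> / (Gamma \<alpha> * Gamma \<beta> * Gamma (\<gamma> - \<mu>)) *
     hyp2F1 (\<alpha> - \<mu>) (\<beta> - \<mu>) (\<gamma> - \<mu>) (of_real x)) {0<..}"
proof -
  define f where "f \<alpha> \<beta> \<gamma> \<mu> t v = of_real t powr (\<beta> - 1) * of_real (1 - t) powr (\<gamma> - \<beta> - 1) *
      (of_real (1 - t * x + t * v) powr (- \<alpha>) * of_real v powr (\<mu> - 1))" for \<alpha> \<beta> \<gamma> \<mu> :: complex and t v :: real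
  define I where "I \<alpha> \<beta> \<gamma> \<mu> t = Beta \<mu> (\<alpha> - \<mu>) * (of_real t powr (\<beta> - \<mu> - 1) *
      of_real (1 - t) powr ((\<gamma> - \<mu>) - (\<beta> - \<mu>) - 1) * (1 - of_real t * of_real x) powr (- (\<alpha> - \<mu>)))"
    for \<alpha> \<beta> \<gamma> \<mu> :: complex and t :: real
  have pos: "1 - t * x > 0" if "t \<in> {0<..<1}" for t
  proof -
    have "t * x < 1"
    proof (cases "x \<le> 0")
      case True
      then have "t * x \<le> 0" using that by (simp add: mult_nonneg_nonpos)
      then show ?thesis by simp
    next
      case False
      then show ?thesis using mult_strict_mono[of t 1 x 1] that x by simp
    qed
    then show ?thesis by simp
  qed
  have pos': "1 - t * x + t * v > 0" if "t \<in> {0<..<1}" "v \<in> {0<..}" for t v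
    using pos[OF that(1)] that by (simp add: add_pos_pos)
  have int_v: "has_lebesgue_integral_on (\<lambda>v. f \<alpha> \<beta> \<gamma> \<mu> t v) (I \<alpha> \<beta> \<gamma> \<mu> t) {0<..}"
    if "Re \<mu> > 0" "Re \<alpha> > Re \<mu>" "t \<in> {0<..<1}" for \<alpha> \<beta> \<gamma> \<mu> t
  proof -
    have "has_lebesgue_integral_on (\<lambda>v. f \<alpha> \<beta> \<gamma> \<mu> t v) (of_real t powr (\<beta> - 1) * of_real (1 - t) powr (\<gamma> - \<beta> - 1) *
        (of_real (1 - t * x) powr (\<mu> - \<alpha>) * of_real t powr (- \<mu>) * Beta \<mu> (\<alpha> - \<mu>))) {0<..}"
      unfolding f_def using that pos
      by (intro has_lebesgue_integral_on_mult has_lebesgue_integral_on_Beta_half_line_scaled) auto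
    moreover have "complex_of_real t powr (\<beta> - \<mu> - 1) = of_real t powr (\<beta> - 1) * of_real t powr (- \<mu>)"
      by (simp add: algebra_simps flip: powr_add)
    ultimately show ?thesis by (simp add: I_def mult_ac)
  qed
  have int_I: "has_lebesgue_integral_on (I \<alpha> \<beta> \<gamma> \<mu>)
      (Beta \<mu> (\<alpha> - \<mu>) * (Beta (\<beta> - \<mu>) (\<gamma> - \<mu> - (\<beta> - \<mu>)) * hyp2F1 (\<alpha> - \<mu>) (\<beta> - \<mu>) (\<gamma> - \<mu>) (of_real x))) {0<..<1}"
    if "Re \<beta> > Re \<mu>" "Re \<gamma> > Re \<beta>" for \<alpha> \<beta> \<gamma> \<mu>
    unfolding I_def[abs_def] using that x
    by (intro has_lebesgue_integral_on_mult Euler_integral of_real_slit_plane) auto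
  \<comment> \<open>At real parameters \<open>I\<close> is real-valued on the unit interval, so
    taking \<open>Re\<close> there loses nothing.\<close>
  define N where "N t = Re (I (of_real (Re \<alpha>)) (of_real (Re \<beta>)) (of_real (Re \<gamma>)) (of_real (Re \<mu>)) t)" for t
  have N: "complex_of_real (N t) = I (of_real (Re \<alpha>)) (of_real (Re \<beta>)) (of_real (Re \<gamma>)) (of_real (Re \<mu>)) t"
    if t: "t \<in> {0<..<1}" for t
  proof -
    have "I (of_real (Re \<alpha>)) (of_real (Re \<beta>)) (of_real (Re \<gamma>)) (of_real (Re \<mu>)) t =
       of_real (Beta (Re \<mu>) (Re \<alpha> - Re \<mu>) * (t powr (Re \<beta> - Re \<mu> - 1) *
      (1 - t) powr ((Re \<gamma> - Re \<mu>) - (Re \<beta> - Re \<mu>) - 1) * (1 - t * x) powr (- (Re \<alpha> - Re \<mu>))))"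
      using t pos[OF t] by (simp add: I_def of_real_of_real_powr Beta_complex_of_real[symmetric])
    then show ?thesis unfolding N_def by simp
  qed
  have "has_lebesgue_integral_on (\<lambda>v. Beta \<beta> (\<gamma> - \<beta>) * (hyp2F1 \<alpha> \<beta> \<gamma> (of_real (x - v)) * of_real v powr (\<mu> - 1)))
      (Beta \<mu> (\<alpha> - \<mu>) * (Beta (\<beta> - \<mu>) (\<gamma> - \<mu> - (\<beta> - \<mu>)) * hyp2F1 (\<alpha> - \<mu>) (\<beta> - \<mu>) (\<gamma> - \<mu>) (of_real x))) {0<..}"
  proof (rule has_lebesgue_integral_on_Fubini[where S = "{0<..<1}" and f = "f \<alpha> \<beta> \<gamma> \<mu>" and I = "I \<alpha> \<beta> \<gamma> \<mu>" and N = N])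
    show "continuous_on ({0<..<1} \<times> {0<..}) (\<lambda>(t, v). f \<alpha> \<beta> \<gamma> \<mu> t v)"
      unfolding f_def case_prod_unfold
      by (intro continuous_on_mult continuous_on_of_real_powr continuous_intros) (auto intro: pos')
    show "has_lebesgue_integral_on (\<lambda>v. of_real (norm (f \<alpha> \<beta> \<gamma> \<mu> t v))) (of_real (N t)) {0<..}"
      if t: "t \<in> {0<..<1}" for t
    proof (subst has_lebesgue_integral_on_cong)
      show "has_lebesgue_integral_on (\<lambda>v. f (of_real (Re \<alpha>)) (of_real (Re \<beta>)) (of_real (Re \<gamma>)) (of_real (Re \<mu>)) t v)
          (of_real (N t)) {0<..}"
        unfolding N[OF t] using \<mu> \<alpha> t by (intro int_v) auto
      fix v :: real assume v: "v \<in> {0<..}"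
      show "complex_of_real (norm (f \<alpha> \<beta> \<gamma> \<mu> t v)) =
          f (of_real (Re \<alpha>)) (of_real (Re \<beta>)) (of_real (Re \<gamma>)) (of_real (Re \<mu>)) t v"
        using t v pos'[OF t v]
        by (simp add: f_def norm_mult norm_of_real_powr of_real_of_real_powr
            del: of_real_add of_real_diff of_real_mult) 
           (simp add: norm_of_real_powr of_real_of_real_powr)
    qed
    show "set_integrable lborel {0<..<1} N"
    proof -
      have "has_lebesgue_integral_on (\<lambda>t. of_real (N t)) (Beta (of_real (Re \<mu>)) (of_real (Re \<alpha>) - of_real (Re \<mu>)) *
          (Beta (of_real (Re \<beta>) - of_real (Re \<mu>)) (of_real (Re \<gamma>) - of_real (Re \<mu>) - (of_real (Re \<beta>) - of_real (Re \<mu>))) *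
           hyp2F1 (of_real (Re \<alpha>) - of_real (Re \<mu>)) (of_real (Re \<beta>) - of_real (Re \<mu>)) (of_real (Re \<gamma>) - of_real (Re \<mu>)) (of_real x))) {0<..<1}"
        using int_I[of "of_real (Re \<mu>)" "of_real (Re \<beta>)" "of_real (Re \<gamma>)" "of_real (Re \<alpha>)"] \<beta> \<gamma>
        by (subst has_lebesgue_integral_on_cong[OF N]) auto
      then have "integrable lborel (\<lambda>t. complex_of_real (indicat_real {0<..<1} t *\<^sub>R N t))"
        by (simp add: has_lebesgue_integral_on_def set_integrable_def scaleR_conv_of_real)
      then show ?thesis unfolding set_integrable_def by (simp only: complex_of_real_integrable_eq)
    qed
    show "(LINT v:{0<..}|lborel. f \<alpha> \<beta> \<gamma> \<mu> t v) = I \<alpha> \<beta> \<gamma> \<mu> t" if "t \<in> {0<..<1}" for t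
      using int_v[OF \<mu> \<alpha> that] unfolding has_lebesgue_integral_on_def by blast
    show "(LINT t:{0<..<1}|lborel. I \<alpha> \<beta> \<gamma> \<mu> t) =
        Beta \<mu> (\<alpha> - \<mu>) * (Beta (\<beta> - \<mu>) (\<gamma> - \<mu> - (\<beta> - \<mu>)) * hyp2F1 (\<alpha> - \<mu>) (\<beta> - \<mu>) (\<gamma> - \<mu>) (of_real x))"
      using int_I[OF \<beta> \<gamma>] unfolding has_lebesgue_integral_on_def by blast
    show "(LINT t:{0<..<1}|lborel. f \<alpha> \<beta> \<gamma> \<mu> t v) =
        Beta \<beta> (\<gamma> - \<beta>) * (hyp2F1 \<alpha> \<beta> \<gamma> (of_real (x - v)) * of_real v powr (\<mu> - 1))" if "v \<in> {0<..}" for v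
    proof -
      have "has_lebesgue_integral_on (\<lambda>t. of_real v powr (\<mu> - 1) * (of_real t powr (\<beta> - 1) * of_real (1 - t) powr (\<gamma> - \<beta> - 1) *
           (1 - of_real t * of_real (x - v)) powr (- \<alpha>))) (of_real v powr (\<mu> - 1) * (Beta \<beta> (\<gamma> - \<beta>) * hyp2F1 \<alpha> \<beta> \<gamma> (of_real (x - v)))) {0<..<1}"
        using \<mu> \<beta> \<gamma> x that by (intro has_lebesgue_integral_on_mult Euler_integral of_real_slit_plane) auto
      moreover have "of_real v powr (\<mu> - 1) * (of_real t powr (\<beta> - 1) * of_real (1 - t) powr (\<gamma> - \<beta> - 1) *
           (1 - of_real t * of_real (x - v)) powr (- \<alpha>)) = f \<alpha> \<beta> \<gamma> \<mu> t v" for t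
      proof -
        have "(1 - of_real t * of_real (x - v)) = complex_of_real (1 - t * x + t * v)"
          by (simp add: algebra_simps)
        then show ?thesis by (simp only: f_def mult_ac)
      qed
      ultimately show ?thesis
        by (simp add: has_lebesgue_integral_on_def mult_ac)
    qed
  qed auto
  from has_lebesgue_integral_on_mult[OF this, of "inverse (Beta \<beta> (\<gamma> - \<beta>))"]
  have *: "has_lebesgue_integral_on (\<lambda>v. inverse (Beta \<beta> (\<gamma> - \<beta>)) * (Beta \<beta> (\<gamma> - \<beta>) * (hyp2F1 \<alpha> \<beta> \<gamma> (of_real (x - v)) * of_real v powr (\<mu> - 1))))
      (inverse (Beta \<beta> (\<gamma> - \<beta>)) * (Beta \<mu> (\<alpha> - \<mu>) * (Beta (\<beta> - \<mu>) (\<gamma> - \<mu> - (\<beta> - \<mu>)) * hyp2F1 (\<alpha> - \<mu>) (\<beta> - \<mu>) (\<gamma> - \<mu>) (of_real x)))) {0<..}" .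
  have G: "Gamma \<beta> \<noteq> 0" "Gamma \<gamma> \<noteq> 0" "Gamma (\<gamma> - \<beta>) \<noteq> 0"
    using \<mu> \<beta> \<gamma> Re_pos_not_nonpos_Int[of \<beta>] Re_pos_not_nonpos_Int[of \<gamma>] Re_pos_not_nonpos_Int[of "\<gamma> - \<beta>"]
    by (auto simp: Gamma_eq_zero_iff)
  then have "inverse (Beta \<beta> (\<gamma> - \<beta>)) * (Beta \<beta> (\<gamma> - \<beta>) * X) = X" for X
    by (simp add: Beta_def)
  \<comment> \<open>\<open>Gamma (\<gamma> - \<beta>)\<close> and
    \<open>Gamma (\<gamma> - \<mu> - (\<beta> - \<mu>))\<close> agree and cancel.\<close>
  moreover have "inverse (Beta \<beta> (\<gamma> - \<beta>)) * (Beta \<mu> (\<alpha> - \<mu>) * (Beta (\<beta> - \<mu>) (\<gamma> - \<mu> - (\<beta> - \<mu>)) * X)) =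
      Gamma \<mu> * Gamma (\<alpha> - \<mu>) * Gamma (\<beta> - \<mu>) * Gamma \<gamma> / (Gamma \<alpha> * Gamma \<beta> * Gamma (\<gamma> - \<mu>)) * X" for X
    using G by (simp add: Beta_def mult_ac)
  ultimately show ?thesis using * by (simp only:)
qed

lemma Gamma_plus1_pos: "Re z > 0 \<Longrightarrow> Gamma (z + 1) = z * Gamma z"
  by (intro Gamma_plus1 Re_pos_not_nonpos_Int)

text \<open>Descent in \<open>\<gamma>\<close>: the contiguous relation expresses the integrand through functions with larger
  \<open>\<gamma> - \<beta>\<close>; writing the factor \<open>x - v\<close> in it as \<open>x\<close> minus \<open>v\<close> produces the exponents \<open>\<mu>\<close> and \<open>\<mu> + 1\<close>.\<close>
lemma Weyl_integral_hyp2F1: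
  assumes "Re \<mu> > 0" "Re \<alpha> > Re \<mu>" "Re \<beta> > Re \<mu>" "\<gamma> \<notin> \<int>\<^sub>\<le>\<^sub>0" "\<gamma> - \<mu> \<notin> \<int>\<^sub>\<le>\<^sub>0" and x: "x < 1"
  shows "has_lebesgue_integral_on (\<lambda>v. hyp2F1 \<alpha> \<beta> \<gamma> (of_real (x - v)) * of_real v powr (\<mu> - 1))
    (Gamma \<mu> * Gamma (\<alpha> - \<mu>) * Gamma (\<beta> - \<mu>) * Gamma \<gamma> / (Gamma \<alpha> * Gamma \<beta> * Gamma (\<gamma> - \<mu>)) *
     hyp2F1 (\<alpha> - \<mu>) (\<beta> - \<mu>) (\<gamma> - \<mu>) (of_real x)) {0<..}"
proof -
  define C where "C \<alpha> \<beta> \<gamma> \<mu> = Gamma \<mu> * Gamma (\<alpha> - \<mu>) * Gamma (\<beta> - \<mu>) * Gamma \<gamma> / (Gamma \<alpha> * Gamma \<beta> * Gamma (\<gamma> - \<mu>))"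
    for \<alpha> \<beta> \<gamma> \<mu> :: complex
  have "has_lebesgue_integral_on (\<lambda>v. hyp2F1 \<alpha> \<beta> \<gamma> (of_real (x - v)) * of_real v powr (\<mu> - 1))
    (C \<alpha> \<beta> \<gamma> \<mu> * hyp2F1 (\<alpha> - \<mu>) (\<beta> - \<mu>) (\<gamma> - \<mu>) (of_real x)) {0<..}"
    if "Re \<gamma> + real n > Re \<beta>" for n
    using that assms(1-5)
  proof (induction n arbitrary: \<alpha> \<beta> \<gamma> \<mu>)
    case 0
    then show ?case unfolding C_def using x by (intro Weyl_integral_hyp2F1_aux) auto
  next
    case (Suc n)
    note \<mu> = Suc.prems(2) and \<alpha> = Suc.prems(3) and \<beta> = Suc.prems(4) and \<gamma> = Suc.prems(5) and \<gamma>\<mu> = Suc.prems(6)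
    have \<gamma>1: "\<gamma> + 1 \<notin> \<int>\<^sub>\<le>\<^sub>0" "\<gamma> + 2 \<notin> \<int>\<^sub>\<le>\<^sub>0" "\<gamma> \<noteq> 0" "\<gamma> + 1 \<noteq> 0"
      using not_nonpos_Int_plus_of_nat[OF \<gamma>, of 1] not_nonpos_Int_plus_of_nat[OF \<gamma>, of 2]
        plus_of_nat_neq_0[OF \<gamma>, of 0] plus_of_nat_neq_0[OF \<gamma>, of 1] by auto
    have \<gamma>2: "\<gamma> + 1 - \<mu> \<notin> \<int>\<^sub>\<le>\<^sub>0" "\<gamma> + 2 - \<mu> \<notin> \<int>\<^sub>\<le>\<^sub>0" "\<gamma> + 2 - (\<mu> + 1) \<notin> \<int>\<^sub>\<le>\<^sub>0" "\<gamma> - \<mu> \<noteq> 0" "\<gamma> - \<mu> + 1 \<noteq> 0"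
      using not_nonpos_Int_plus_of_nat[OF \<gamma>\<mu>, of 1] not_nonpos_Int_plus_of_nat[OF \<gamma>\<mu>, of 2]
        plus_of_nat_neq_0[OF \<gamma>\<mu>, of 0] plus_of_nat_neq_0[OF \<gamma>\<mu>, of 1] by (auto simp: algebra_simps)
    define d where "d = \<alpha> * \<beta> / (\<gamma> + 1)"
    have i1: "has_lebesgue_integral_on (\<lambda>v. hyp2F1 \<alpha> \<beta> (\<gamma> + 1) (of_real (x - v)) * of_real v powr (\<mu> - 1))
        (C \<alpha> \<beta> (\<gamma> + 1) \<mu> * hyp2F1 (\<alpha> - \<mu>) (\<beta> - \<mu>) (\<gamma> + 1 - \<mu>) (of_real x)) {0<..}"
      using Suc.prems \<gamma>1 \<gamma>2 by (intro Suc.IH) auto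
    have i2: "has_lebesgue_integral_on (\<lambda>v. hyp2F1 (\<alpha> + 1) (\<beta> + 1) (\<gamma> + 2) (of_real (x - v)) * of_real v powr (\<mu> - 1))
        (C (\<alpha> + 1) (\<beta> + 1) (\<gamma> + 2) \<mu> * hyp2F1 (\<alpha> + 1 - \<mu>) (\<beta> + 1 - \<mu>) (\<gamma> + 2 - \<mu>) (of_real x)) {0<..}"
      using Suc.prems \<gamma>1 \<gamma>2 by (intro Suc.IH) auto
    \<comment> \<open>The factor v makes this the integral for \<mu> + 1, which is why the induction
      also generalises \<mu>. As \<alpha> and \<beta> rise by one too, the conditions on real parts
      persist.\<close>
    have i3: "has_lebesgue_integral_on (\<lambda>v. hyp2F1 (\<alpha> + 1) (\<beta> + 1) (\<gamma> + 2) (of_real (x - v)) * of_real v powr (\<mu> + 1 - 1))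
        (C (\<alpha> + 1) (\<beta> + 1) (\<gamma> + 2) (\<mu> + 1) * hyp2F1 (\<alpha> + 1 - (\<mu> + 1)) (\<beta> + 1 - (\<mu> + 1)) (\<gamma> + 2 - (\<mu> + 1)) (of_real x)) {0<..}"
      using Suc.prems \<gamma>1 \<gamma>2 by (intro Suc.IH) auto
    let ?F = "hyp2F1 (\<alpha> - \<mu>) (\<beta> - \<mu>) (\<gamma> - \<mu>) (of_real x)"
      and ?F1 = "hyp2F1 (\<alpha> - \<mu>) (\<beta> - \<mu>) (\<gamma> - \<mu> + 1) (of_real x)"
      and ?F2 = "hyp2F1 (\<alpha> - \<mu> + 1) (\<beta> - \<mu> + 1) (\<gamma> - \<mu> + 2) (of_real x)"
    have "has_lebesgue_integral_on (\<lambda>v. inverse \<gamma> * (\<gamma> * (hyp2F1 \<alpha> \<beta> (\<gamma> + 1) (of_real (x - v)) * of_real v powr (\<mu> - 1)) +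
        (d * of_real x * (hyp2F1 (\<alpha> + 1) (\<beta> + 1) (\<gamma> + 2) (of_real (x - v)) * of_real v powr (\<mu> - 1)) +
        (- d) * (hyp2F1 (\<alpha> + 1) (\<beta> + 1) (\<gamma> + 2) (of_real (x - v)) * of_real v powr (\<mu> + 1 - 1)))))
      (inverse \<gamma> * (\<gamma> * (C \<alpha> \<beta> (\<gamma> + 1) \<mu> * hyp2F1 (\<alpha> - \<mu>) (\<beta> - \<mu>) (\<gamma> + 1 - \<mu>) (of_real x)) +
       (d * of_real x * (C (\<alpha> + 1) (\<beta> + 1) (\<gamma> + 2) \<mu> * hyp2F1 (\<alpha> + 1 - \<mu>) (\<beta> + 1 - \<mu>) (\<gamma> + 2 - \<mu>) (of_real x)) +
        (- d) * (C (\<alpha> + 1) (\<beta> + 1) (\<gamma> + 2) (\<mu> + 1) * hyp2F1 (\<alpha> + 1 - (\<mu> + 1)) (\<beta> + 1 - (\<mu> + 1)) (\<gamma> + 2 - (\<mu> + 1)) (of_real x)))))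
      {0<..}" (is "has_lebesgue_integral_on ?L ?R _")
      by (intro has_lebesgue_integral_on_mult has_lebesgue_integral_on_add i1 i2 i3)
    moreover have "?L v = hyp2F1 \<alpha> \<beta> \<gamma> (of_real (x - v)) * of_real v powr (\<mu> - 1)" if "v \<in> {0<..}" for v
    proof -
      have "complex_of_real v powr (\<mu> + 1 - 1) = of_real v * of_real v powr (\<mu> - 1)"
        using powr_add[of "complex_of_real v" 1 "\<mu> - 1"] that by (simp add: add.commute)
      then have "?L v = inverse \<gamma> * (\<gamma> * hyp2F1 \<alpha> \<beta> (\<gamma> + 1) (of_real (x - v)) +
          d * of_real (x - v) * hyp2F1 (\<alpha> + 1) (\<beta> + 1) (\<gamma> + 2) (of_real (x - v))) * of_real v powr (\<mu> - 1)"
        by (simp add: algebra_simps)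
      also have "\<gamma> * hyp2F1 \<alpha> \<beta> (\<gamma> + 1) (of_real (x - v)) +
          d * of_real (x - v) * hyp2F1 (\<alpha> + 1) (\<beta> + 1) (\<gamma> + 2) (of_real (x - v)) = \<gamma> * hyp2F1 \<alpha> \<beta> \<gamma> (of_real (x - v))"
        unfolding d_def using x that by (intro hyp2F1_contiguous_lower[symmetric] \<gamma> of_real_slit_plane) auto
      finally show ?thesis using \<gamma>1 by simp
    qed
    moreover have "?R = C \<alpha> \<beta> \<gamma> \<mu> * ?F"
    proof -
      have nz: "\<alpha> \<noteq> 0" "\<beta> \<noteq> 0" "\<mu> \<noteq> 0" using \<mu> \<alpha> \<beta> by auto
      have pos: "Gamma (\<alpha> + 1) = \<alpha> * Gamma \<alpha>" "Gamma (\<beta> + 1) = \<beta> * Gamma \<beta>" "Gamma (\<mu> + 1) = \<mu> * Gamma \<mu>"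
        "Gamma (\<alpha> - \<mu> + 1) = (\<alpha> - \<mu>) * Gamma (\<alpha> - \<mu>)" "Gamma (\<beta> - \<mu> + 1) = (\<beta> - \<mu>) * Gamma (\<beta> - \<mu>)"
        using \<mu> \<alpha> \<beta> by (auto intro!: Gamma_plus1_pos)
      have g: "Gamma (\<gamma> + 1) = \<gamma> * Gamma \<gamma>" "Gamma (\<gamma> - \<mu> + 1) = (\<gamma> - \<mu>) * Gamma (\<gamma> - \<mu>)"
        using \<gamma> \<gamma>\<mu> by (auto intro!: Gamma_plus1)
      have "Gamma (\<gamma> + 1 + 1) = (\<gamma> + 1) * Gamma (\<gamma> + 1)" "Gamma (\<gamma> - \<mu> + 1 + 1) = (\<gamma> - \<mu> + 1) * Gamma (\<gamma> - \<mu> + 1)"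
        using \<gamma>1 \<gamma>2 by (intro Gamma_plus1; simp add: diff_add_eq)+
      then have g2: "Gamma (\<gamma> + 2) = (\<gamma> + 1) * (\<gamma> * Gamma \<gamma>)"
        "Gamma (\<gamma> - \<mu> + 2) = (\<gamma> - \<mu> + 1) * ((\<gamma> - \<mu>) * Gamma (\<gamma> - \<mu>))"
        unfolding g by (simp_all add: add.assoc)
      have args: "\<gamma> + 1 - \<mu> = \<gamma> - \<mu> + 1" "\<alpha> + 1 - \<mu> = \<alpha> - \<mu> + 1" "\<beta> + 1 - \<mu> = \<beta> - \<mu> + 1"
        "\<gamma> + 2 - \<mu> = \<gamma> - \<mu> + 2" "\<alpha> + 1 - (\<mu> + 1) = \<alpha> - \<mu>" "\<beta> + 1 - (\<mu> + 1) = \<beta> - \<mu>" "\<gamma> + 2 - (\<mu> + 1) = \<gamma> - \<mu> + 1"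
        by simp_all
      have e1: "C \<alpha> \<beta> (\<gamma> + 1) \<mu> = \<gamma> / (\<gamma> - \<mu>) * C \<alpha> \<beta> \<gamma> \<mu>"
        unfolding C_def args g by (simp add: mult_ac)
      have e2: "d * C (\<alpha> + 1) (\<beta> + 1) (\<gamma> + 2) \<mu> =
          \<gamma> * ((\<alpha> - \<mu>) * (\<beta> - \<mu>) / (\<gamma> - \<mu> + 1)) / (\<gamma> - \<mu>) * C \<alpha> \<beta> \<gamma> \<mu>"
        unfolding C_def d_def args pos g2 using nz \<gamma>1 by (simp add: mult_ac)
      have e3: "d * C (\<alpha> + 1) (\<beta> + 1) (\<gamma> + 2) (\<mu> + 1) = \<gamma> * \<mu> / (\<gamma> - \<mu>) * C \<alpha> \<beta> \<gamma> \<mu>"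
        unfolding C_def d_def args pos g g2 using nz \<gamma>1 by (simp add: mult_ac)
      \<comment> \<open>The integrals \<open>i1\<close> and \<open>i3\<close> both yield multiples
        of \<open>?F1\<close>; relative to \<open>C \<alpha> \<beta> \<gamma> \<mu>\<close> their
        weights \<gamma> / (\<gamma> - \<mu>) and -\<mu> / (\<gamma> - \<mu>) add up to 1. The
        result is the contiguous relation at the parameters lowered by \<mu>.\<close>
      have "?R = inverse \<gamma> * (\<gamma> * C \<alpha> \<beta> (\<gamma> + 1) \<mu> * ?F1 + (d * C (\<alpha> + 1) (\<beta> + 1) (\<gamma> + 2) \<mu>) * of_real x * ?F2 -
          (d * C (\<alpha> + 1) (\<beta> + 1) (\<gamma> + 2) (\<mu> + 1)) * ?F1)"
        unfolding args by (simp add: mult_ac)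
      also have "\<dots> = C \<alpha> \<beta> \<gamma> \<mu> / (\<gamma> - \<mu>) * ((\<gamma> - \<mu>) * ?F1 + (\<alpha> - \<mu>) * (\<beta> - \<mu>) / (\<gamma> - \<mu> + 1) * of_real x * ?F2)"
        unfolding e1 e2 e3 using \<gamma>1(3) \<gamma>2(4) by (simp add: divide_simps) (simp add: algebra_simps)
      also have "(\<gamma> - \<mu>) * ?F1 + (\<alpha> - \<mu>) * (\<beta> - \<mu>) / (\<gamma> - \<mu> + 1) * of_real x * ?F2 = (\<gamma> - \<mu>) * ?F"
        using x by (intro hyp2F1_contiguous_lower[symmetric] \<gamma>\<mu> of_real_slit_plane)
      finally show ?thesis using \<gamma>2(4) by simp
    qed
    ultimately show ?case by (subst (asm) has_lebesgue_integral_on_cong) auto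
  qed
  moreover obtain n where "real n > Re \<beta> - Re \<gamma>" using reals_Archimedean2 by blast
  ultimately show ?thesis unfolding C_def by (auto simp: algebra_simps)
qed

section \<open>Reduction of fractional integrals to the unit interval\<close>

lemma of_real_mult_powr:
  "p > 0 \<Longrightarrow> q > 0 \<Longrightarrow> complex_of_real (p * q) powr z = of_real p powr z * of_real q powr z"
  by (simp add: of_real_powr_eq_exp ln_mult distrib_left exp_add del: of_real_mult)

lemma of_real_divide_powr:
  "p > 0 \<Longrightarrow> q > 0 \<Longrightarrow> complex_of_real (p / q) powr z = of_real p powr z * of_real q powr (- z)"
  by (simp add: of_real_powr_eq_exp ln_div right_diff_distrib del: of_real_divide flip: exp_add)

text \<open>With y = x t, for x of either sign, the Jacobian and the two powers contribute |x|^(1 +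
  (s - 1) + (\<mu> - 1)).\<close>

lemma Riemann_Liouville_from_unit_interval:
  fixes G :: "real \<Rightarrow> complex"
  assumes x: "x \<noteq> 0" and G: "continuous_on {y. 0 < y / x \<and> y / x < 1} G"
    and int: "has_lebesgue_integral_on (\<lambda>t. of_real t powr (s - 1) * of_real (1 - t) powr (\<mu> - 1) * G (x * t)) J {0<..<1}"
  shows "has_lebesgue_integral_on (\<lambda>y. of_real \<bar>y\<bar> powr (s - 1) * G y * (of_real \<bar>x - y\<bar> powr (\<mu> - 1) / Gamma \<mu>))
           (of_real \<bar>x\<bar> powr (s + \<mu> - 1) * (J / Gamma \<mu>)) {y. 0 < y / x \<and> y / x < 1}"
proof -
  have eq: "(*) x ` {0<..<1} = {y. 0 < y / x \<and> y / x < 1}"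
    using x by (auto simp: image_iff intro!: bexI[of _ "_ / x"])
  have "{y. 0 < y / x \<and> y / x < 1} \<in> sets borel" by measurable
  then have meas: "(*) x ` {0<..<1} \<in> sets borel" unfolding eq .
  have "has_lebesgue_integral_on (\<lambda>y. of_real \<bar>y\<bar> powr (s - 1) * G y * (of_real \<bar>x - y\<bar> powr (\<mu> - 1) / Gamma \<mu>))
           (of_real \<bar>x\<bar> powr (s + \<mu> - 1) * (J / Gamma \<mu>)) ((*) x ` {0<..<1})"
  proof (rule has_lebesgue_integral_on_change_of_variables[OF _ meas, where g' = "\<lambda>_. x"])
    show "continuous_on ((*) x ` {0<..<1}) (\<lambda>y. of_real \<bar>y\<bar> powr (s - 1) * G y * (of_real \<bar>x - y\<bar> powr (\<mu> - 1) / Gamma \<mu>))"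
      unfolding eq divide_inverse
      by (intro continuous_on_mult continuous_on_of_real_powr G[unfolded divide_inverse] continuous_intros) (use x in auto)
    have "has_lebesgue_integral_on (\<lambda>t. of_real \<bar>x\<bar> powr (s + \<mu> - 1) / Gamma \<mu> *
        (of_real t powr (s - 1) * of_real (1 - t) powr (\<mu> - 1) * G (x * t)))
        (of_real \<bar>x\<bar> powr (s + \<mu> - 1) / Gamma \<mu> * J) {0<..<1}"
      by (intro has_lebesgue_integral_on_mult int)
    moreover have "of_real \<bar>x\<bar> * (of_real \<bar>x * t\<bar> powr (s - 1) * G (x * t) * (of_real \<bar>x - x * t\<bar> powr (\<mu> - 1) / Gamma \<mu>)) =
        of_real \<bar>x\<bar> powr (s + \<mu> - 1) / Gamma \<mu> *
        (of_real t powr (s - 1) * of_real (1 - t) powr (\<mu> - 1) * G (x * t))" if t: "t \<in> {0<..<1}" for t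
    proof -
      have "x - x * t = x * (1 - t)" by (simp add: right_diff_distrib)
      then have "\<bar>x - x * t\<bar> = \<bar>x\<bar> * (1 - t)" using t by (simp only: abs_mult) simp
      moreover have "\<bar>x * t\<bar> = \<bar>x\<bar> * t" using t by (simp add: abs_mult)
      moreover have "of_real \<bar>x\<bar> powr (s + \<mu> - 1) = complex_of_real \<bar>x\<bar> * of_real \<bar>x\<bar> powr (s - 1) * of_real \<bar>x\<bar> powr (\<mu> - 1)"
        using x powr_add[of "complex_of_real \<bar>x\<bar>" "s - 1" "\<mu>"] powr_add[of "complex_of_real \<bar>x\<bar>" "\<mu> - 1" 1]
        by (simp add: algebra_simps)
      ultimately show ?thesis
        using t x by (simp add: of_real_mult_powr del: of_real_mult of_real_diff)
    qed
    ultimately show "has_lebesgue_integral_on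
       (\<lambda>t. of_real \<bar>x\<bar> * (of_real \<bar>x * t\<bar> powr (s - 1) * G (x * t) * (of_real \<bar>x - x * t\<bar> powr (\<mu> - 1) / Gamma \<mu>)))
       (of_real \<bar>x\<bar> powr (s + \<mu> - 1) * (J / Gamma \<mu>)) {0<..<1}"
      by (subst has_lebesgue_integral_on_cong) auto
    show "((*) x has_real_derivative x) (at t within {0<..<1})" for t
      by (auto intro!: derivative_eq_intros)
  qed (use x in \<open>auto simp: inj_on_def\<close>)
  then show ?thesis unfolding eq .
qed

lemma has_lebesgue_integral_on_reflect:
  assumes "S \<in> sets borel" "continuous_on S f" "has_lebesgue_integral_on f I S"
  shows "has_lebesgue_integral_on (\<lambda>y. f (1 - y)) I {y. 1 - y \<in> S}"
proof -
  have eq: "(-) 1 ` S = {y. 1 - y \<in> S}"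
    by (auto simp: image_iff intro!: bexI[of _ "1 - _"])
  have meas: "(-) 1 ` S \<in> sets borel"
    unfolding eq using assms(1) by measurable
  have "has_lebesgue_integral_on (\<lambda>y. f (1 - y)) I ((-) 1 ` S)"
  proof (rule has_lebesgue_integral_on_change_of_variables[OF assms(1) meas, where g' = "\<lambda>_. - 1"])
    show "continuous_on ((-) 1 ` S) (\<lambda>y. f (1 - y))"
      unfolding eq by (intro continuous_on_compose2[OF assms(2)] continuous_intros) auto
    show "((-) 1 has_real_derivative - 1) (at t within S)" for t
      by (auto intro!: derivative_eq_intros)
  qed (use assms(3) in \<open>auto simp: inj_on_def\<close>)
  then show ?thesis unfolding eq .
qed

text \<open>The reflection y -> 1 - y moves the base point from 0 to 1 and preserves the distance |x
  - y| in the kernel.\<close>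

lemma Riemann_Liouville_at_1_from_unit_interval:
  fixes G :: "real \<Rightarrow> complex"
  assumes x: "x \<noteq> 1" and G: "continuous_on {y. 0 < y / (1 - x) \<and> y / (1 - x) < 1} G"
    and int: "has_lebesgue_integral_on (\<lambda>t. of_real t powr (s - 1) * of_real (1 - t) powr (\<mu> - 1) * G ((1 - x) * t)) J {0<..<1}"
  shows "has_lebesgue_integral_on (\<lambda>y. of_real \<bar>1 - y\<bar> powr (s - 1) * G (1 - y) * (of_real \<bar>x - y\<bar> powr (\<mu> - 1) / Gamma \<mu>))
           (of_real \<bar>1 - x\<bar> powr (s + \<mu> - 1) * (J / Gamma \<mu>)) {y. 0 < (1 - y) / (1 - x) \<and> (1 - y) / (1 - x) < 1}"
proof -
  let ?S = "{y. 0 < y / (1 - x) \<and> y / (1 - x) < 1}"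
  let ?f = "\<lambda>y. of_real \<bar>y\<bar> powr (s - 1) * G y * (of_real \<bar>(1 - x) - y\<bar> powr (\<mu> - 1) / Gamma \<mu>)"
  have "?S \<in> sets borel" by measurable
  moreover have "continuous_on ?S ?f"
    unfolding divide_inverse
    by (intro continuous_on_mult continuous_on_of_real_powr G[unfolded divide_inverse] continuous_intros)
       (use x in \<open>auto simp: divide_inverse[symmetric]\<close>)
  moreover have "has_lebesgue_integral_on ?f (of_real \<bar>1 - x\<bar> powr (s + \<mu> - 1) * (J / Gamma \<mu>)) ?S"
    using x by (intro Riemann_Liouville_from_unit_interval G int) auto
  ultimately have "has_lebesgue_integral_on (\<lambda>y. ?f (1 - y)) (of_real \<bar>1 - x\<bar> powr (s + \<mu> - 1) * (J / Gamma \<mu>)) {y. 1 - y \<in> ?S}"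
    by (rule has_lebesgue_integral_on_reflect)
  moreover have "\<bar>(1 - x) - (1 - y)\<bar> = \<bar>x - y\<bar>" for y by simp
  ultimately show ?thesis by simp
qed

text \<open>With y = x / t and Jacobian |x| / t^2, the powers of |x| combine to |x|^(-s) and those
  of t to -2 + (s + \<mu>) - (\<mu> - 1) = s - 1. The weight exponent -s - \<mu> is chosen for
  this.\<close>

lemma Weyl_from_unit_interval:
  fixes G :: "real \<Rightarrow> complex"
  assumes x: "x \<noteq> 0" and G: "continuous_on {y. y / x > 1} (\<lambda>y. G (inverse y))"
    and int: "has_lebesgue_integral_on (\<lambda>t. of_real t powr (s - 1) * of_real (1 - t) powr (\<mu> - 1) * G (inverse x * t)) J {0<..<1}"
  shows "has_lebesgue_integral_on (\<lambda>y. of_real \<bar>y\<bar> powr (- s - \<mu>) * G (inverse y) * (of_real \<bar>x - y\<bar> powr (\<mu> - 1) / Gamma \<mu>))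
           (of_real \<bar>x\<bar> powr (- s) * (J / Gamma \<mu>)) {y. y / x > 1}"
proof -
  define g where "g t = x / t" for t
  have eq: "g ` {0<..<1} = {y. y / x > 1}"
  proof -
    have "y \<in> g ` {0<..<1}" if "y / x > 1" for y
    proof (rule image_eqI[of _ _ "x / y"])
      have "0 < y / x" using that by linarith
      moreover have "x / y = inverse (y / x)" by simp
      ultimately show "x / y \<in> {0<..<1}"
        using that by (simp only: greaterThanLessThan_iff inverse_positive_iff_positive inverse_less_1_iff) simp
      show "y = g (x / y)" using x that by (auto simp: g_def)
    qed
    then show ?thesis using x by (auto simp: g_def)
  qed
  have "{y. y / x > 1} \<in> sets borel" by measurable
  then have meas: "g ` {0<..<1} \<in> sets borel" unfolding eq .
  have "has_lebesgue_integral_on (\<lambda>y. of_real \<bar>y\<bar> powr (- s - \<mu>) * G (inverse y) * (of_real \<bar>x - y\<bar> powr (\<mu> - 1) / Gamma \<mu>))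
           (of_real \<bar>x\<bar> powr (- s) * (J / Gamma \<mu>)) (g ` {0<..<1})"
  proof (rule has_lebesgue_integral_on_change_of_variables[OF _ meas, where g' = "\<lambda>t. - x / t^2"])
    show "continuous_on (g ` {0<..<1}) (\<lambda>y. of_real \<bar>y\<bar> powr (- s - \<mu>) * G (inverse y) * (of_real \<bar>x - y\<bar> powr (\<mu> - 1) / Gamma \<mu>))"
      unfolding eq divide_inverse
      by (intro continuous_on_mult continuous_on_of_real_powr G[unfolded divide_inverse] continuous_intros) (use x in auto)
    have "has_lebesgue_integral_on (\<lambda>t. of_real \<bar>x\<bar> powr (- s) / Gamma \<mu> *
        (of_real t powr (s - 1) * of_real (1 - t) powr (\<mu> - 1) * G (inverse x * t)))
        (of_real \<bar>x\<bar> powr (- s) / Gamma \<mu> * J) {0<..<1}"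
      by (intro has_lebesgue_integral_on_mult int)
    moreover have "of_real \<bar>- x / t^2\<bar> * (of_real \<bar>g t\<bar> powr (- s - \<mu>) * G (inverse (g t)) *
          (of_real \<bar>x - g t\<bar> powr (\<mu> - 1) / Gamma \<mu>)) =
        of_real \<bar>x\<bar> powr (- s) / Gamma \<mu> *
        (of_real t powr (s - 1) * of_real (1 - t) powr (\<mu> - 1) * G (inverse x * t))" if t: "t \<in> {0<..<1}" for t
    proof -
      have "x - g t = x * (- (1 - t) / t)" using t by (simp add: g_def field_simps)
      then have "\<bar>x - g t\<bar> = \<bar>x\<bar> * ((1 - t) / t)" using t by (simp only: abs_mult) simp
      then have e1: "complex_of_real \<bar>x - g t\<bar> powr (\<mu> - 1) =
          exp ((\<mu> - 1) * of_real (ln \<bar>x\<bar>)) * (of_real (1 - t) powr (\<mu> - 1) * exp (- (\<mu> - 1) * of_real (ln t)))"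
        using t x by (simp add: of_real_mult_powr of_real_divide_powr of_real_powr_eq_exp[of "\<bar>x\<bar>"] of_real_powr_eq_exp[of t]
            del: of_real_mult of_real_divide of_real_diff)
      have "\<bar>g t\<bar> = \<bar>x\<bar> / t" using t by (simp add: g_def)
      then have e2: "complex_of_real \<bar>g t\<bar> powr (- s - \<mu>) = exp ((- s - \<mu>) * of_real (ln \<bar>x\<bar>)) * exp ((s + \<mu>) * of_real (ln t))"
        using t x by (simp add: of_real_divide_powr of_real_powr_eq_exp[of "\<bar>x\<bar>"] of_real_powr_eq_exp[of t] add.commute
            del: of_real_mult of_real_divide of_real_diff)
      have "\<bar>- x / t^2\<bar> = exp (ln \<bar>x\<bar>) * exp (- (2 * ln t))"
        using t x by (simp add: exp_minus exp_double divide_inverse abs_mult)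
      then have e3: "complex_of_real \<bar>- x / t^2\<bar> = exp (of_real (ln \<bar>x\<bar>)) * exp (- (2 * of_real (ln t)))"
        by (simp only: of_real_mult exp_of_real[symmetric] of_real_minus of_real_numeral)
      have e4: "of_real \<bar>x\<bar> powr (- s) = exp ((- s) * complex_of_real (ln \<bar>x\<bar>))"
        "of_real t powr (s - 1) = exp ((s - 1) * complex_of_real (ln t))"
        using t x by (simp_all add: of_real_powr_eq_exp)
      have e5: "inverse (g t) = inverse x * t" by (simp add: g_def divide_inverse mult.commute)
      \<comment> \<open>Separates the exponentials, whose exponents must be added, from the factors
        \<open>Z\<close>, \<open>r\<close>, \<open>\<Gamma>\<close> common to both sides.\<close>
      have assemble: "m * (w * Z * (u * (r * v) / \<Gamma>)) = h / \<Gamma> * (k * r * Z)"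
        if "m * (w * (u * v)) = h * k" for m w u r v h k Z \<Gamma> :: complex
      proof -
        have "m * (w * Z * (u * (r * v) / \<Gamma>)) = (m * (w * (u * v))) * (r * Z / \<Gamma>)"
          by (simp add: mult_ac)
        then show ?thesis unfolding that by (simp add: mult_ac)
      qed
      show ?thesis unfolding e1 e2 e3 e4 e5
        by (rule assemble, simp only: mult_exp_exp) (simp add: algebra_simps)
    qed
    ultimately show "has_lebesgue_integral_on
       (\<lambda>t. of_real \<bar>- x / t^2\<bar> * (of_real \<bar>g t\<bar> powr (- s - \<mu>) * G (inverse (g t)) *
          (of_real \<bar>x - g t\<bar> powr (\<mu> - 1) / Gamma \<mu>)))
       (of_real \<bar>x\<bar> powr (- s) * (J / Gamma \<mu>)) {0<..<1}"
      by (subst has_lebesgue_integral_on_cong) auto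
    show "(g has_real_derivative - x / t^2) (at t within {0<..<1})" if "t \<in> {0<..<1}" for t
      using that unfolding g_def by (auto intro!: derivative_eq_intros simp: power2_eq_square)
    show "inj_on g {0<..<1}" using x by (auto simp: inj_on_def g_def)
    show "continuous_on {0<..<1} (\<lambda>t. - x / t^2)" by (intro continuous_intros) auto
  qed auto
  then show ?thesis unfolding eq .
qed

lemma has_lebesgue_integral_on_half_line_below:
  assumes "continuous_on {..<x} f" "has_lebesgue_integral_on (\<lambda>v. f (x - v)) I {0<..}"
  shows "has_lebesgue_integral_on f I {..<x :: real}"
proof -
  have eq: "(-) x ` {0<..} = {..<x}"
    by (auto simp: image_iff intro!: bexI[of _ "x - _"])
  have "has_lebesgue_integral_on f I ((-) x ` {0<..})"
  proof (rule has_lebesgue_integral_on_change_of_variables[where g' = "\<lambda>_. - 1"])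
    show "((-) x has_real_derivative - 1) (at t within {0<..})" for t
      by (auto intro!: derivative_eq_intros)
  qed (use assms in \<open>auto simp: eq inj_on_def\<close>)
  then show ?thesis unfolding eq .
qed

section \<open>Fractional integrals of the hypergeometric function\<close>

lemma continuous_on_hyp2F1_of_real:
  assumes "c \<notin> \<int>\<^sub>\<le>\<^sub>0" "continuous_on S h" "\<And>y. y \<in> S \<Longrightarrow> h y < 1"
  shows "continuous_on S (\<lambda>y. hyp2F1 a b c (of_real (h y)))"
  by (rule continuous_on_compose2[OF holomorphic_on_imp_continuous_on[OF holomorphic_hyp2F1[OF assms(1)]]])
     (auto intro!: continuous_intros assms of_real_slit_plane)

lemma Beta_mult_divide_Gamma: "Re \<mu> > 0 \<Longrightarrow> Beta s \<mu> * h / Gamma \<mu> = Gamma s / Gamma (s + \<mu>) * h"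
  using Re_pos_not_nonpos_Int[of \<mu>] by (simp add: Beta_def Gamma_eq_zero_iff)

lemma powr_mult_powr: "(x :: complex) powr p * (x powr q * r) = x powr (p + q) * r"
  by (simp add: powr_add)

lemma less_1_of_between: "x < 1 \<Longrightarrow> 0 < y / x \<Longrightarrow> y / x < 1 \<Longrightarrow> y < (1 :: real)"
  by (cases "x > 0") (auto simp: zero_less_divide_iff divide_less_eq)

lemma inverse_less_1_of_beyond: "x < 0 \<or> x > 1 \<Longrightarrow> y / x > 1 \<Longrightarrow> inverse y < (1 :: real)"
  by (auto simp: less_divide_eq inverse_less_1_iff split: if_splits)

lemma Riemann_Liouville_hyp2F1_lower:
  assumes x: "x \<noteq> 0" "x < 1" and c: "Re c > 0" and \<mu>: "Re \<mu> > 0"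
  shows "has_lebesgue_integral_on
    (\<lambda>y. of_real \<bar>y\<bar> powr (c - 1) * hyp2F1 a b c (of_real y) * (of_real \<bar>x - y\<bar> powr (\<mu> - 1) / Gamma \<mu>))
    (of_real \<bar>x\<bar> powr (c + \<mu> - 1) * (Gamma c / Gamma (c + \<mu>) * hyp2F1 a b (c + \<mu>) (of_real x)))
    {y. 0 < y / x \<and> y / x < 1}"
proof -
  have "has_lebesgue_integral_on (\<lambda>t. of_real t powr (c - 1) * of_real (1 - t) powr (\<mu> - 1) * hyp2F1 a b c (of_real (x * t)))
      (Beta c \<mu> * hyp2F1 a b (c + \<mu>) (of_real x)) {0<..<1}"
    using Bateman_integral_lower[OF c \<mu> of_real_slit_plane[OF x(2)], of a b] by (simp add: mult.commute)
  moreover have "continuous_on {y. 0 < y / x \<and> y / x < 1} (\<lambda>y. hyp2F1 a b c (of_real y))"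
    using less_1_of_between[OF x(2)]
    by (intro continuous_on_hyp2F1_of_real Re_pos_not_nonpos_Int c continuous_intros) auto
  ultimately show ?thesis
    using Riemann_Liouville_from_unit_interval[OF x(1)] unfolding Beta_mult_divide_Gamma[OF \<mu>, symmetric] by blast
qed

lemma Riemann_Liouville_at_1_hyp2F1_lower:
  assumes x: "x \<noteq> 1" "x > 0" and c: "Re c > 0" and \<mu>: "Re \<mu> > 0"
  shows "has_lebesgue_integral_on
    (\<lambda>y. of_real \<bar>1 - y\<bar> powr (c - 1) * hyp2F1 a b c (of_real (1 - y)) * (of_real \<bar>x - y\<bar> powr (\<mu> - 1) / Gamma \<mu>))
    (of_real \<bar>1 - x\<bar> powr (c + \<mu> - 1) * (Gamma c / Gamma (c + \<mu>) * hyp2F1 a b (c + \<mu>) (of_real (1 - x))))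
    {y. 0 < (1 - y) / (1 - x) \<and> (1 - y) / (1 - x) < 1}"
proof -
  have x': "1 - x < 1" using x by simp
  have "has_lebesgue_integral_on (\<lambda>t. of_real t powr (c - 1) * of_real (1 - t) powr (\<mu> - 1) * hyp2F1 a b c (of_real ((1 - x) * t)))
      (Beta c \<mu> * hyp2F1 a b (c + \<mu>) (of_real (1 - x))) {0<..<1}"
    using Bateman_integral_lower[OF c \<mu> of_real_slit_plane[OF x'], of a b] by (simp add: mult.commute)
  moreover have "continuous_on {y. 0 < y / (1 - x) \<and> y / (1 - x) < 1} (\<lambda>y. hyp2F1 a b c (of_real y))"
    using less_1_of_between[OF x']
    by (intro continuous_on_hyp2F1_of_real Re_pos_not_nonpos_Int c continuous_intros) auto
  ultimately show ?thesis
    using Riemann_Liouville_at_1_from_unit_interval[OF x(1), of "\<lambda>y. hyp2F1 a b c (of_real y)"]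
    unfolding Beta_mult_divide_Gamma[OF \<mu>, symmetric] by blast
qed

lemma Riemann_Liouville_hyp2F1_upper:
  assumes x: "x \<noteq> 0" "x < 1" and c: "c \<notin> \<int>\<^sub>\<le>\<^sub>0" and s: "Re s > 0" and \<mu>: "Re \<mu> > 0"
  shows "has_lebesgue_integral_on
    (\<lambda>y. of_real \<bar>y\<bar> powr (s - 1) * hyp2F1 (s + \<mu>) b c (of_real y) * (of_real \<bar>x - y\<bar> powr (\<mu> - 1) / Gamma \<mu>))
    (of_real \<bar>x\<bar> powr (s + \<mu> - 1) * (Gamma s / Gamma (s + \<mu>) * hyp2F1 s b c (of_real x)))
    {y. 0 < y / x \<and> y / x < 1}"
proof -
  have "has_lebesgue_integral_on (\<lambda>t. of_real t powr (s - 1) * of_real (1 - t) powr (\<mu> - 1) * hyp2F1 (s + \<mu>) b c (of_real (x * t)))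
      (Beta s \<mu> * hyp2F1 s b c (of_real x)) {0<..<1}"
    using Bateman_integral_upper[OF s \<mu> c of_real_slit_plane[OF x(2)], of b] by (simp add: mult.commute)
  moreover have "continuous_on {y. 0 < y / x \<and> y / x < 1} (\<lambda>y. hyp2F1 (s + \<mu>) b c (of_real y))"
    using less_1_of_between[OF x(2)] by (intro continuous_on_hyp2F1_of_real c continuous_intros) auto
  ultimately show ?thesis
    using Riemann_Liouville_from_unit_interval[OF x(1)] unfolding Beta_mult_divide_Gamma[OF \<mu>, symmetric] by blast
qed

lemma Weyl_hyp2F1_inverse:
  assumes x: "x < 0 \<or> x > 1" and c: "c \<notin> \<int>\<^sub>\<le>\<^sub>0" and s: "Re s > 0" and \<mu>: "Re \<mu> > 0"
  shows "has_lebesgue_integral_on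
    (\<lambda>y. of_real \<bar>y\<bar> powr (- s - \<mu>) * hyp2F1 (s + \<mu>) b c (of_real (inverse y)) * (of_real \<bar>x - y\<bar> powr (\<mu> - 1) / Gamma \<mu>))
    (of_real \<bar>x\<bar> powr (- s) * (Gamma s / Gamma (s + \<mu>) * hyp2F1 s b c (of_real (inverse x))))
    {y. y / x > 1}"
proof -
  have x': "inverse x < 1" "x \<noteq> 0" using x by (auto simp: inverse_less_1_iff)
  have "has_lebesgue_integral_on (\<lambda>t. of_real t powr (s - 1) * of_real (1 - t) powr (\<mu> - 1) * hyp2F1 (s + \<mu>) b c (of_real (inverse x * t)))
      (Beta s \<mu> * hyp2F1 s b c (of_real (inverse x))) {0<..<1}"
    using Bateman_integral_upper[OF s \<mu> c of_real_slit_plane[OF x'(1)], of b] by (simp add: mult.commute)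
  moreover have "continuous_on {y. y / x > 1} (\<lambda>y. hyp2F1 (s + \<mu>) b c (of_real (inverse y)))"
  proof (rule continuous_on_hyp2F1_of_real[OF c])
    show "continuous_on {y. y / x > 1} inverse" by (intro continuous_intros) auto
  qed (use inverse_less_1_of_beyond[OF x] in auto)
  ultimately show ?thesis
    using Weyl_from_unit_interval[OF x'(2), of "\<lambda>y. hyp2F1 (s + \<mu>) b c (of_real y)" s \<mu>]
    unfolding Beta_mult_divide_Gamma[OF \<mu>, symmetric] by blast
qed

text \<open>Continuity is exported with the integral because the reflection that carries this half
  line to the one used for \<open>w5\<close> asks for it.\<close>

lemma Weyl_hyp2F1_half_line_below:
  assumes "Re \<mu> > 0" "Re \<alpha> > Re \<mu>" "Re \<beta> > Re \<mu>" "\<gamma> \<notin> \<int>\<^sub>\<le>\<^sub>0" "\<gamma> - \<mu> \<notin> \<int>\<^sub>\<le>\<^sub>0" and x: "x < 1"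
  shows "has_lebesgue_integral_on (\<lambda>y. hyp2F1 \<alpha> \<beta> \<gamma> (of_real y) * (of_real (x - y) powr (\<mu> - 1) / Gamma \<mu>))
    (Gamma (\<alpha> - \<mu>) / Gamma \<alpha> * (Gamma (\<beta> - \<mu>) / Gamma \<beta>) * (Gamma \<gamma> / Gamma (\<gamma> - \<mu>)) *
     hyp2F1 (\<alpha> - \<mu>) (\<beta> - \<mu>) (\<gamma> - \<mu>) (of_real x)) {..<x}"
    and "continuous_on {..<x} (\<lambda>y. hyp2F1 \<alpha> \<beta> \<gamma> (of_real y) * (of_real (x - y) powr (\<mu> - 1) / Gamma \<mu>))"
proof -
  show cont: "continuous_on {..<x} (\<lambda>y. hyp2F1 \<alpha> \<beta> \<gamma> (of_real y) * (of_real (x - y) powr (\<mu> - 1) / Gamma \<mu>))"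
    unfolding divide_inverse using x assms(4)
    by (intro continuous_on_mult continuous_on_of_real_powr continuous_on_hyp2F1_of_real continuous_intros) auto
  have "Gamma \<mu> \<noteq> 0" using assms(1) Re_pos_not_nonpos_Int[of \<mu>] by (simp add: Gamma_eq_zero_iff)
  then have "has_lebesgue_integral_on (\<lambda>v. hyp2F1 \<alpha> \<beta> \<gamma> (of_real (x - v)) * (of_real v powr (\<mu> - 1) / Gamma \<mu>))
    (Gamma (\<alpha> - \<mu>) / Gamma \<alpha> * (Gamma (\<beta> - \<mu>) / Gamma \<beta>) * (Gamma \<gamma> / Gamma (\<gamma> - \<mu>)) *
     hyp2F1 (\<alpha> - \<mu>) (\<beta> - \<mu>) (\<gamma> - \<mu>) (of_real x)) {0<..}"
    using has_lebesgue_integral_on_mult[OF Weyl_integral_hyp2F1[OF assms], of "inverse (Gamma \<mu>)"]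
    by (simp add: field_simps)
  then show "has_lebesgue_integral_on (\<lambda>y. hyp2F1 \<alpha> \<beta> \<gamma> (of_real y) * (of_real (x - y) powr (\<mu> - 1) / Gamma \<mu>))
    (Gamma (\<alpha> - \<mu>) / Gamma \<alpha> * (Gamma (\<beta> - \<mu>) / Gamma \<beta>) * (Gamma \<gamma> / Gamma (\<gamma> - \<mu>)) *
     hyp2F1 (\<alpha> - \<mu>) (\<beta> - \<mu>) (\<gamma> - \<mu>) (of_real x)) {..<x}"
    by (intro has_lebesgue_integral_on_half_line_below cont) simp
qed

text \<open>For 0 < x < 1 the range of the \<open>w2\<close> integral on a half line contains 0,
  where the weight fails to cancel. Measurability of the new integrand is obtained by viewing it as
  a one-point modification.\<close>

lemma has_lebesgue_integral_on_spike:
  assumes "has_lebesgue_integral_on f I S" "\<And>y. y \<in> S \<Longrightarrow> y \<noteq> p \<Longrightarrow> g y = f y"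
  shows "has_lebesgue_integral_on g I S"
proof -
  let ?f = "\<lambda>y. indicator S y *\<^sub>R f y" and ?g = "\<lambda>y. indicator S y *\<^sub>R g y"
  have f: "integrable lborel ?f" using assms(1) by (simp add: has_lebesgue_integral_on_def set_integrable_def)
  then have [measurable]: "?f \<in> borel_measurable lborel" by (rule borel_measurable_integrable)
  have "?g = (\<lambda>y. if y = p then ?g p else ?f y)"
    using assms(2) by (auto simp: fun_eq_iff indicator_def)
  also have "\<dots> \<in> borel_measurable lborel" by measurable
  finally have [measurable]: "?g \<in> borel_measurable lborel" .
  have ae: "AE y in lborel. ?g y = ?f y"
    using AE_lborel_singleton[of p] by eventually_elim (use assms(2) in \<open>auto simp: indicator_def\<close>)
  have "integrable lborel ?g \<longleftrightarrow> integrable lborel ?f" "integral\<^sup>L lborel ?g = integral\<^sup>L lborel ?f"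
    by (rule integrable_cong_AE integral_cong_AE; use ae in simp)+
  then show ?thesis
    using assms(1) by (simp add: has_lebesgue_integral_on_def set_integrable_def set_lebesgue_integral_def)
qed

text \<open>Euler's transformation at 1 - y produces the factor y^(C - A - B); the condition on the
  parameters says that the weight y^(c - 1) removes it. Both \<open>w5\<close> and \<open>w6\<close>
  satisfy this condition.\<close>

lemma powr_mult_hyp2F1_Euler:
  assumes "C \<notin> \<int>\<^sub>\<le>\<^sub>0" "y > 0" "C - A - B = 1 - c"
  shows "of_real y powr (c - 1) * hyp2F1 A B C (of_real (1 - y)) = hyp2F1 (C - A) (C - B) C (of_real (1 - y))"
proof -
  have "1 - y < 1" using assms by simp
  from hyp2F1_Euler_transformation[OF assms(1) of_real_slit_plane[OF this], of A B]
  have "hyp2F1 A B C (of_real (1 - y)) = of_real y powr (1 - c) * hyp2F1 (C - A) (C - B) C (of_real (1 - y))"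
    using assms(3) by simp
  then have "of_real y powr (c - 1) * hyp2F1 A B C (of_real (1 - y)) =
      of_real y powr (c - 1 + (1 - c)) * hyp2F1 (C - A) (C - B) C (of_real (1 - y))"
    by (simp only: powr_mult_powr)
  then show ?thesis using assms by simp
qed

section \<open>The identities for the individual solutions\<close>

lemma integral_w1:
  assumes "Re \<mu> > 0" "x \<in> {..<0} \<union> {0<..<1}" "Re c > 0"
  shows "has_lebesgue_integral_on
          (\<lambda>y. of_real \<bar>y\<bar> powr (c - 1) * w1 y a b c * (of_real \<bar>x - y\<bar> powr (\<mu> - 1) / Gamma \<mu>))
          (Gamma c / Gamma (c + \<mu>) * of_real \<bar>x\<bar> powr (c + \<mu> - 1) * w1 x a b (c + \<mu>))
          {y. 0 < y / x \<and> y / x < 1}"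
  using Riemann_Liouville_hyp2F1_lower[of x c \<mu> a b] assms by (auto simp: w1_def mult_ac)

lemma integral_w2_half_line:
  assumes "Re \<mu> > 0" "x \<in> {..<0} \<union> {0<..<1}" "Re (a - c + 1) > Re \<mu>" "Re (b - c + 1) > Re \<mu>"
    "2 - c \<notin> \<int>\<^sub>\<le>\<^sub>0" "2 - (c + \<mu>) \<notin> \<int>\<^sub>\<le>\<^sub>0"
  shows "has_lebesgue_integral_on
          (\<lambda>y. of_real \<bar>y\<bar> powr (c - 1) * w2 y a b c * (of_real (x - y) powr (\<mu> - 1) / Gamma \<mu>))
          (Gamma (a - c - \<mu> + 1) / Gamma (a - c + 1) * (Gamma (b - c - \<mu> + 1) / Gamma (b - c + 1)) *
           (Gamma (2 - c) / Gamma (2 - c - \<mu>)) *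
           of_real \<bar>x\<bar> powr (c + \<mu> - 1) * w2 x a b (c + \<mu>))
          {..<x}"
proof -
  have args: "a - c + 1 - \<mu> = a - c - \<mu> + 1" "b - c + 1 - \<mu> = b - c - \<mu> + 1"
    "a - (c + \<mu>) + 1 = a - c - \<mu> + 1" "b - (c + \<mu>) + 1 = b - c - \<mu> + 1" "2 - (c + \<mu>) = 2 - c - \<mu>"
    by simp_all
  \<comment> \<open>General in \<open>c\<close>: it is applied at c to the integrand and at c +
    \<mu> to the right-hand side.\<close>
  have cancel: "of_real \<bar>y\<bar> powr (c - 1) * w2 y a b c = hyp2F1 (a - c + 1) (b - c + 1) (2 - c) (of_real y)"
    if "y \<noteq> 0" for y c
    unfolding w2_def powr_mult_powr using that by simp
  have w2x: "of_real \<bar>x\<bar> powr (c + \<mu> - 1) * w2 x a b (c + \<mu>) =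
      hyp2F1 (a - c - \<mu> + 1) (b - c - \<mu> + 1) (2 - c - \<mu>) (of_real x)"
    using cancel[of x "c + \<mu>"] assms(2) unfolding args by auto
  have "has_lebesgue_integral_on (\<lambda>y. hyp2F1 (a - c + 1) (b - c + 1) (2 - c) (of_real y) * (of_real (x - y) powr (\<mu> - 1) / Gamma \<mu>))
      (Gamma (a - c - \<mu> + 1) / Gamma (a - c + 1) * (Gamma (b - c - \<mu> + 1) / Gamma (b - c + 1)) *
       (Gamma (2 - c) / Gamma (2 - c - \<mu>)) * hyp2F1 (a - c - \<mu> + 1) (b - c - \<mu> + 1) (2 - c - \<mu>) (of_real x)) {..<x}"
    using Weyl_hyp2F1_half_line_below(1)[of \<mu> "a - c + 1" "b - c + 1" "2 - c" x] assms unfolding args by auto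
  \<comment> \<open>The cancellation fails at \<open>y = 0\<close>, where \<open>0 powr z = 0\<close>.\<close>
  then show ?thesis
    unfolding mult.assoc[of _ "of_real \<bar>x\<bar> powr (c + \<mu> - 1)"] w2x
    by (rule has_lebesgue_integral_on_spike[where p = 0]) (simp add: cancel)
qed

text \<open>Shifting c moves only the upper parameter a - c + 1, which therefore plays the role of s
  + \<mu>; symmetry in the upper parameters brings it to the front. The total power of |y| is c - 1
  - a = -(s + \<mu>), as required.\<close>

lemma integral_w3:
  assumes "Re \<mu> > 0" "x \<in> {..<0} \<union> {1<..}" "Re (a - c + 1) > Re \<mu>" "a - b + 1 \<notin> \<int>\<^sub>\<le>\<^sub>0"
  shows "has_lebesgue_integral_on
          (\<lambda>y. of_real \<bar>y\<bar> powr (c - 1) * w3 y a b c * (of_real \<bar>x - y\<bar> powr (\<mu> - 1) / Gamma \<mu>))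
          (Gamma (a - c - \<mu> + 1) / Gamma (a - c + 1) *
           of_real \<bar>x\<bar> powr (c + \<mu> - 1) * w3 x a b (c + \<mu>))
          {y. y / x > 1}"
proof -
  define s where "s = a - c - \<mu> + 1"
  have args: "s + \<mu> = a - c + 1" "- s - \<mu> = c - 1 + - a" "c + \<mu> - 1 + - a = - s" "a - (c + \<mu>) + 1 = s"
    by (simp_all add: s_def)
  have "Re s > 0" using assms by (simp add: s_def)
  then have "has_lebesgue_integral_on
    (\<lambda>y. of_real \<bar>y\<bar> powr (c - 1 + - a) * hyp2F1 (a - c + 1) a (a - b + 1) (of_real (inverse y)) * (of_real \<bar>x - y\<bar> powr (\<mu> - 1) / Gamma \<mu>))
    (of_real \<bar>x\<bar> powr (- s) * (Gamma s / Gamma (a - c + 1) * hyp2F1 s a (a - b + 1) (of_real (inverse x))))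
    {y. y / x > 1}"
    using Weyl_hyp2F1_inverse[of x "a - b + 1" s \<mu> a] assms unfolding args by auto
  then show ?thesis
    unfolding w3_def mult.assoc[of _ "of_real \<bar>x\<bar> powr (c + \<mu> - 1)"] powr_mult_powr args
      s_def[symmetric] hyp2F1_commute[of a]
    by (simp only: mult_ac)
qed

text \<open>Lowering a moves only the upper parameter a - c + 1. The weight exponent a - \<mu> - 1
  together with 1 - c from \<open>w2\<close> gives s - 1 for s = a - c - \<mu> + 1.\<close>

lemma integral_w2_segment:
  assumes "Re \<mu> > 0" "x \<in> {..<0} \<union> {0<..<1}" "Re (a - c + 1) > Re \<mu>" "2 - c \<notin> \<int>\<^sub>\<le>\<^sub>0"
  shows "has_lebesgue_integral_on
          (\<lambda>y. of_real \<bar>y\<bar> powr (a - \<mu> - 1) * w2 y a b c * (of_real \<bar>x - y\<bar> powr (\<mu> - 1) / Gamma \<mu>))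
          (Gamma (a - c - \<mu> + 1) / Gamma (a - c + 1) *
           of_real \<bar>x\<bar> powr (a - 1) * w2 x (a - \<mu>) b c)
          {y. 0 < y / x \<and> y / x < 1}"
proof -
  define s where "s = a - c - \<mu> + 1"
  have args: "s + \<mu> = a - c + 1" "a - \<mu> - 1 + (1 - c) = s - 1" "a - c + 1 - 1 = a - 1 + (1 - c)" "a - \<mu> - c + 1 = s"
    by (simp_all add: s_def)
  have "Re s > 0" using assms by (simp add: s_def)
  then have "has_lebesgue_integral_on
    (\<lambda>y. of_real \<bar>y\<bar> powr (s - 1) * hyp2F1 (a - c + 1) (b - c + 1) (2 - c) (of_real y) * (of_real \<bar>x - y\<bar> powr (\<mu> - 1) / Gamma \<mu>))
    (of_real \<bar>x\<bar> powr (a - 1 + (1 - c)) * (Gamma s / Gamma (a - c + 1) * hyp2F1 s (b - c + 1) (2 - c) (of_real x)))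
    {y. 0 < y / x \<and> y / x < 1}"
    using Riemann_Liouville_hyp2F1_upper[of x "2 - c" s \<mu> "b - c + 1"] assms unfolding args by auto
  then show ?thesis
    unfolding w2_def mult.assoc[of _ "of_real \<bar>x\<bar> powr (a - 1)"] powr_mult_powr args s_def[symmetric]
    by (simp only: mult_ac)
qed

text \<open>Lowering a, b and c together fixes b - c + 1 and b - a + 1, so in F only the upper
  parameter b moves, in step with the outer power |x|^(-b).\<close>

lemma integral_w4:
  assumes "Re \<mu> > 0" "x \<in> {..<0} \<union> {1<..}" "Re b > Re \<mu>" "b - a + 1 \<notin> \<int>\<^sub>\<le>\<^sub>0"
  shows "has_lebesgue_integral_on
          (\<lambda>y. w4 y a b c * (of_real \<bar>x - y\<bar> powr (\<mu> - 1) / Gamma \<mu>))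
          (Gamma (b - \<mu>) / Gamma b * w4 x (a - \<mu>) (b - \<mu>) (c - \<mu>))
          {y. y / x > 1}"
  using Weyl_hyp2F1_inverse[of x "b - a + 1" "b - \<mu>" \<mu> "b - c + 1"] assms
  by (auto simp: w4_def mult_ac)

text \<open>Once Euler's transformation has absorbed the weight, the parameters b - c + 1, a - c + 1
  and a + b - c + 1 all drop by \<mu> when c becomes c + \<mu>: the pattern of the Weyl integral,
  reflected by y -> 1 - y.\<close>

lemma integral_w5:
  assumes "Re \<mu> > 0" "x > 0" "Re (a - c + 1) > Re \<mu>" "Re (b - c + 1) > Re \<mu>"
    "a + b - c + 1 \<notin> \<int>\<^sub>\<le>\<^sub>0" "a + b - (c + \<mu>) + 1 \<notin> \<int>\<^sub>\<le>\<^sub>0"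
  shows "has_lebesgue_integral_on
          (\<lambda>y. of_real y powr (c - 1) * w5 y a b c * (of_real (y - x) powr (\<mu> - 1) / Gamma \<mu>))
          (Gamma (b - c - \<mu> + 1) / Gamma (b - c + 1) * (Gamma (a - c - \<mu> + 1) / Gamma (a - c + 1)) *
           (Gamma (a + b - c + 1) / Gamma (a + b - c - \<mu> + 1)) *
           of_real x powr (c + \<mu> - 1) * w5 x a b (c + \<mu>))
          {x<..}"
proof -
  have euler: "of_real y powr (c - 1) * w5 y a b c = hyp2F1 (b - c + 1) (a - c + 1) (a + b - c + 1) (of_real (1 - y))"
    if "y > 0" "a + b - c + 1 \<notin> \<int>\<^sub>\<le>\<^sub>0" for y c
    using powr_mult_hyp2F1_Euler[OF that(2,1), of a b c] by (simp add: w5_def algebra_simps)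
  have args: "b - c + 1 - \<mu> = b - c - \<mu> + 1" "a - c + 1 - \<mu> = a - c - \<mu> + 1" "a + b - c + 1 - \<mu> = a + b - c - \<mu> + 1"
    "b - (c + \<mu>) + 1 = b - c - \<mu> + 1" "a - (c + \<mu>) + 1 = a - c - \<mu> + 1" "a + b - (c + \<mu>) + 1 = a + b - c - \<mu> + 1"
    by simp_all
  have w5x: "of_real x powr (c + \<mu> - 1) * w5 x a b (c + \<mu>) =
      hyp2F1 (b - c - \<mu> + 1) (a - c - \<mu> + 1) (a + b - c - \<mu> + 1) (of_real (1 - x))"
    using euler[OF assms(2,6)] unfolding args .
  let ?f = "\<lambda>y. hyp2F1 (b - c + 1) (a - c + 1) (a + b - c + 1) (of_real y) * (of_real ((1 - x) - y) powr (\<mu> - 1) / Gamma \<mu>)"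
  have W: "has_lebesgue_integral_on ?f
      (Gamma (b - c - \<mu> + 1) / Gamma (b - c + 1) * (Gamma (a - c - \<mu> + 1) / Gamma (a - c + 1)) *
       (Gamma (a + b - c + 1) / Gamma (a + b - c - \<mu> + 1)) *
       hyp2F1 (b - c - \<mu> + 1) (a - c - \<mu> + 1) (a + b - c - \<mu> + 1) (of_real (1 - x))) {..<1 - x}" "continuous_on {..<1 - x} ?f"
    using Weyl_hyp2F1_half_line_below[of \<mu> "b - c + 1" "a - c + 1" "a + b - c + 1" "1 - x"] assms
    unfolding args by auto
  have "has_lebesgue_integral_on (\<lambda>y. ?f (1 - y))
      (Gamma (b - c - \<mu> + 1) / Gamma (b - c + 1) * (Gamma (a - c - \<mu> + 1) / Gamma (a - c + 1)) *
       (Gamma (a + b - c + 1) / Gamma (a + b - c - \<mu> + 1)) *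
       hyp2F1 (b - c - \<mu> + 1) (a - c - \<mu> + 1) (a + b - c - \<mu> + 1) (of_real (1 - x))) {y. 1 - y \<in> {..<1 - x}}"
    by (rule has_lebesgue_integral_on_reflect[OF _ W(2,1)]) simp
  also have "{y. 1 - y \<in> {..<1 - x}} = {x<..}" by auto
  finally show ?thesis
    unfolding mult.assoc[of _ "of_real x powr (c + \<mu> - 1)"] w5x
    using assms euler[of _ c] by (subst has_lebesgue_integral_on_cong) auto
qed

text \<open>Euler's transformation turns the upper parameters into 1 - b and 1 - a, free of c. Only
  the lower parameter and the power of |1 - y| then move with c.\<close>

lemma integral_w6_weighted:
  assumes "Re \<mu> > 0" "x \<in> {0<..<1} \<union> {1<..}" "Re (c - a - b + 1) > 0"
  shows "has_lebesgue_integral_on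
          (\<lambda>y. of_real y powr (c - 1) * w6 y a b c * (of_real \<bar>y - x\<bar> powr (\<mu> - 1) / Gamma \<mu>))
          (Gamma (c - a - b + 1) / Gamma (c - a - b + \<mu> + 1) *
           of_real x powr (c + \<mu> - 1) * w6 x a b (c + \<mu>))
          {y. 0 < (1 - y) / (1 - x) \<and> (1 - y) / (1 - x) < 1}"
proof -
  have euler: "of_real y powr (c - 1) * w6 y a b c =
      of_real \<bar>1 - y\<bar> powr (c - a - b) * hyp2F1 (1 - b) (1 - a) (c - a - b + 1) (of_real (1 - y))"
    if "y > 0" "Re (c - a - b + 1) > 0" for y c
    using powr_mult_hyp2F1_Euler[OF Re_pos_not_nonpos_Int[OF that(2)] that(1), of "c - a" "c - b" c]
    by (simp add: w6_def mult.left_commute)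
  \<comment> \<open>The range is the open segment between 1 and x, so x > 0 keeps 1 - y off the
    cut.\<close>
  have pos: "y > 0" if "0 < (1 - y) / (1 - x)" "(1 - y) / (1 - x) < 1" for y
    using that assms(2) by (cases "x < 1") (auto simp: zero_less_divide_iff divide_less_eq)
  have args: "c - a - b + 1 + \<mu> = c - a - b + \<mu> + 1" "c - a - b + \<mu> + 1 - 1 = c + \<mu> - a - b" "c - a - b + 1 - 1 = c - a - b"
    "c + \<mu> - a - b + 1 = c - a - b + \<mu> + 1"
    by simp_all
  have w6x: "of_real x powr (c + \<mu> - 1) * w6 x a b (c + \<mu>) =
      of_real \<bar>1 - x\<bar> powr (c + \<mu> - a - b) * hyp2F1 (1 - b) (1 - a) (c - a - b + \<mu> + 1) (of_real (1 - x))"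
    using euler[of x "c + \<mu>"] assms unfolding args by auto
  have "has_lebesgue_integral_on
    (\<lambda>y. of_real \<bar>1 - y\<bar> powr (c - a - b) * hyp2F1 (1 - b) (1 - a) (c - a - b + 1) (of_real (1 - y)) * (of_real \<bar>x - y\<bar> powr (\<mu> - 1) / Gamma \<mu>))
    (of_real \<bar>1 - x\<bar> powr (c + \<mu> - a - b) * (Gamma (c - a - b + 1) / Gamma (c - a - b + \<mu> + 1) *
      hyp2F1 (1 - b) (1 - a) (c - a - b + \<mu> + 1) (of_real (1 - x))))
    {y. 0 < (1 - y) / (1 - x) \<and> (1 - y) / (1 - x) < 1}"
    using Riemann_Liouville_at_1_hyp2F1_lower[of x "c - a - b + 1" \<mu> "1 - b" "1 - a"] assms
    unfolding args by auto
  then show ?thesis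
    unfolding mult.assoc[of _ "of_real x powr (c + \<mu> - 1)"] w6x
    using assms(3) euler[of _ c] pos by (subst has_lebesgue_integral_on_cong) (auto simp: abs_minus_commute mult_ac)
qed

text \<open>The simultaneous shift fixes c - a and c - b and raises c - a - b by \<mu>, so the
  lower-parameter integral at base point 1 applies directly.\<close>

lemma integral_w6:
  assumes "Re \<mu> > 0" "x \<in> {0<..<1} \<union> {1<..}" "Re (c - a - b + 1) > 0"
  shows "has_lebesgue_integral_on
          (\<lambda>y. w6 y a b c * (of_real \<bar>x - y\<bar> powr (\<mu> - 1) / Gamma \<mu>))
          (Gamma (c - a - b + 1) / Gamma (c - a - b + \<mu> + 1) * w6 x (a - \<mu>) (b - \<mu>) (c - \<mu>))
          {y. 0 < (1 - y) / (1 - x) \<and> (1 - y) / (1 - x) < 1}"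
proof -
  have args: "c - a - b + 1 + \<mu> = c - a - b + \<mu> + 1" "c - a - b + 1 + \<mu> - 1 = c - a - b + \<mu>" "c - a - b + 1 - 1 = c - a - b"
    "c - a - (b - \<mu>) = c - a - b + \<mu>" "c - \<mu> - (a - \<mu>) = c - a" "c - \<mu> - (b - \<mu>) = c - b"
    by simp_all
  have "has_lebesgue_integral_on
    (\<lambda>y. of_real \<bar>1 - y\<bar> powr (c - a - b) * hyp2F1 (c - a) (c - b) (c - a - b + 1) (of_real (1 - y)) * (of_real \<bar>x - y\<bar> powr (\<mu> - 1) / Gamma \<mu>))
    (of_real \<bar>1 - x\<bar> powr (c - a - b + \<mu>) * (Gamma (c - a - b + 1) / Gamma (c - a - b + \<mu> + 1) *
      hyp2F1 (c - a) (c - b) (c - a - b + \<mu> + 1) (of_real (1 - x))))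
    {y. 0 < (1 - y) / (1 - x) \<and> (1 - y) / (1 - x) < 1}"
    using Riemann_Liouville_at_1_hyp2F1_lower[of x "c - a - b + 1" \<mu> "c - a" "c - b"] assms
    unfolding args by auto
  then show ?thesis
    unfolding w6_def args by (simp only: mult_ac)
qed

theorem mainTheorem8:
  fixes a b c \<mu> :: complex
  assumes "Re \<mu> > 0"
  shows
    "(\<forall>x\<in>{..<0} \<union> {0<..<1}. Re c > 0 \<and> c \<notin> \<int>\<^sub>\<le>\<^sub>0 \<and> c + \<mu> \<notin> \<int>\<^sub>\<le>\<^sub>0 \<longrightarrow>
        has_lebesgue_integral_on
          (\<lambda>y. of_real \<bar>y\<bar> powr (c - 1) * w1 y a b c * (of_real \<bar>x - y\<bar> powr (\<mu> - 1) / Gamma \<mu>))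
          (Gamma c / Gamma (c + \<mu>) * of_real \<bar>x\<bar> powr (c + \<mu> - 1) * w1 x a b (c + \<mu>))
          {y. 0 < y / x \<and> y / x < 1})
   \<and> (\<forall>x\<in>{..<0} \<union> {0<..<1}. Re (a - c + 1) > Re \<mu> \<and> Re (b - c + 1) > Re \<mu> \<and>
          2 - c \<notin> \<int>\<^sub>\<le>\<^sub>0 \<and> 2 - (c + \<mu>) \<notin> \<int>\<^sub>\<le>\<^sub>0 \<longrightarrow>
        has_lebesgue_integral_on
          (\<lambda>y. of_real \<bar>y\<bar> powr (c - 1) * w2 y a b c * (of_real (x - y) powr (\<mu> - 1) / Gamma \<mu>))
          (Gamma (a - c - \<mu> + 1) / Gamma (a - c + 1) * (Gamma (b - c - \<mu> + 1) / Gamma (b - c + 1)) *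
           (Gamma (2 - c) / Gamma (2 - c - \<mu>)) *
           of_real \<bar>x\<bar> powr (c + \<mu> - 1) * w2 x a b (c + \<mu>))
          {..<x})
   \<and> (\<forall>x\<in>{..<0} \<union> {1<..}. Re (a - c + 1) > Re \<mu> \<and> a - b + 1 \<notin> \<int>\<^sub>\<le>\<^sub>0 \<longrightarrow>
        has_lebesgue_integral_on
          (\<lambda>y. of_real \<bar>y\<bar> powr (c - 1) * w3 y a b c * (of_real \<bar>x - y\<bar> powr (\<mu> - 1) / Gamma \<mu>))
          (Gamma (a - c - \<mu> + 1) / Gamma (a - c + 1) *
           of_real \<bar>x\<bar> powr (c + \<mu> - 1) * w3 x a b (c + \<mu>))
          {y. y / x > 1})
   \<and> (\<forall>x\<in>{..<0} \<union> {1<..}. Re (b - c + 1) > Re \<mu> \<and> b - a + 1 \<notin> \<int>\<^sub>\<le>\<^sub>0 \<longrightarrow>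
        has_lebesgue_integral_on
          (\<lambda>y. of_real \<bar>y\<bar> powr (c - 1) * w4 y a b c * (of_real \<bar>x - y\<bar> powr (\<mu> - 1) / Gamma \<mu>))
          (Gamma (b - c - \<mu> + 1) / Gamma (b - c + 1) *
           of_real \<bar>x\<bar> powr (c + \<mu> - 1) * w4 x a b (c + \<mu>))
          {y. y / x > 1})
   \<and> (\<forall>x\<in>{0<..}. Re (a - c + 1) > Re \<mu> \<and> Re (b - c + 1) > Re \<mu> \<and>
          a + b - c + 1 \<notin> \<int>\<^sub>\<le>\<^sub>0 \<and> a + b - (c + \<mu>) + 1 \<notin> \<int>\<^sub>\<le>\<^sub>0 \<longrightarrow>
        has_lebesgue_integral_on
          (\<lambda>y. of_real y powr (c - 1) * w5 y a b c * (of_real (y - x) powr (\<mu> - 1) / Gamma \<mu>))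
          (Gamma (b - c - \<mu> + 1) / Gamma (b - c + 1) * (Gamma (a - c - \<mu> + 1) / Gamma (a - c + 1)) *
           (Gamma (a + b - c + 1) / Gamma (a + b - c - \<mu> + 1)) *
           of_real x powr (c + \<mu> - 1) * w5 x a b (c + \<mu>))
          {x<..})
   \<and> (\<forall>x\<in>{0<..<1} \<union> {1<..}. Re (c - a - b + 1) > 0 \<and>
          c - a - b + 1 \<notin> \<int>\<^sub>\<le>\<^sub>0 \<and> (c + \<mu>) - a - b + 1 \<notin> \<int>\<^sub>\<le>\<^sub>0 \<longrightarrow>
        has_lebesgue_integral_on
          (\<lambda>y. of_real y powr (c - 1) * w6 y a b c * (of_real \<bar>y - x\<bar> powr (\<mu> - 1) / Gamma \<mu>))
          (Gamma (c - a - b + 1) / Gamma (c - a - b + \<mu> + 1) *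
           of_real x powr (c + \<mu> - 1) * w6 x a b (c + \<mu>))
          {y. 0 < (1 - y) / (1 - x) \<and> (1 - y) / (1 - x) < 1})
   \<and> (\<forall>x\<in>{..<0} \<union> {0<..<1}. Re (a - c + 1) > Re \<mu> \<and> 2 - c \<notin> \<int>\<^sub>\<le>\<^sub>0 \<longrightarrow>
        has_lebesgue_integral_on
          (\<lambda>y. of_real \<bar>y\<bar> powr (a - \<mu> - 1) * w2 y a b c * (of_real \<bar>x - y\<bar> powr (\<mu> - 1) / Gamma \<mu>))
          (Gamma (a - c - \<mu> + 1) / Gamma (a - c + 1) *
           of_real \<bar>x\<bar> powr (a - 1) * w2 x (a - \<mu>) b c)
          {y. 0 < y / x \<and> y / x < 1})
   \<and> (\<forall>x\<in>{..<0} \<union> {1<..}. Re b > Re \<mu> \<and>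
          b - a + 1 \<notin> \<int>\<^sub>\<le>\<^sub>0 \<and> (b - \<mu>) - (a - \<mu>) + 1 \<notin> \<int>\<^sub>\<le>\<^sub>0 \<longrightarrow>
        has_lebesgue_integral_on
          (\<lambda>y. w4 y a b c * (of_real \<bar>x - y\<bar> powr (\<mu> - 1) / Gamma \<mu>))
          (Gamma (b - \<mu>) / Gamma b * w4 x (a - \<mu>) (b - \<mu>) (c - \<mu>))
          {y. y / x > 1})
   \<and> (\<forall>x\<in>{0<..<1} \<union> {1<..}. Re (c - a - b + 1) > 0 \<and>
          c - a - b + 1 \<notin> \<int>\<^sub>\<le>\<^sub>0 \<and> (c - \<mu>) - (a - \<mu>) - (b - \<mu>) + 1 \<notin> \<int>\<^sub>\<le>\<^sub>0 \<longrightarrow>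
        has_lebesgue_integral_on
          (\<lambda>y. w6 y a b c * (of_real \<bar>x - y\<bar> powr (\<mu> - 1) / Gamma \<mu>))
          (Gamma (c - a - b + 1) / Gamma (c - a - b + \<mu> + 1) * w6 x (a - \<mu>) (b - \<mu>) (c - \<mu>))
          {y. 0 < (1 - y) / (1 - x) \<and> (1 - y) / (1 - x) < 1})"
proof (intro conjI ballI impI; elim conjE)
  \<comment> \<open>Exchanging a and b turns \<open>w3\<close> into \<open>w4\<close>, so the
    weighted identity for \<open>w4\<close> is that for \<open>w3\<close> with a and b
    swapped.\<close>
  fix x :: real assume x: "x \<in> {..<0} \<union> {1<..}" and b: "Re (b - c + 1) > Re \<mu>" "b - a + 1 \<notin> \<int>\<^sub>\<le>\<^sub>0"
  show "has_lebesgue_integral_on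
          (\<lambda>y. of_real \<bar>y\<bar> powr (c - 1) * w4 y a b c * (of_real \<bar>x - y\<bar> powr (\<mu> - 1) / Gamma \<mu>))
          (Gamma (b - c - \<mu> + 1) / Gamma (b - c + 1) *
           of_real \<bar>x\<bar> powr (c + \<mu> - 1) * w4 x a b (c + \<mu>))
          {y. y / x > 1}"
    using integral_w3[OF assms x b] by (simp only: w3_def w4_def)
qed ((rule integral_w1 integral_w2_half_line integral_w3 integral_w5 integral_w6_weighted
      integral_w2_segment integral_w4 integral_w6; (rule assms | assumption | simp))+)

end
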